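(* If $k$ and $m$ are positive integers, then \[R^{cl}(\omega\cdot m+1,k+1)<\omega^\omega.\]
   Context: All arithmetic operations on ordinals are in the ordinal sense. Every ordinal is identified with the set of smaller ordinals and carries the order topology; subsets carry the subspace topology. A set $X$ of ordinals is order-homeomorphic to an ordinal $\alpha$ (a closed copy of $\alpha$) if there is a bijection $X\to\alpha$ that is both an order-isomorphism and a homeomorphism; equivalently, $X$ is order-isomorphic to $\alpha$ and closed in its supremum. $[X]^2$ is the set of $2$-element subsets of $X$. $R^{cl}(\alpha,k)$ is the least ordinal $\beta$ such that for every coloring $c:[\beta]^2\to\{\text{red},\text{blue}\}$ either there is $X\subseteq\beta$ order-homeomorphic to $\alpha$ with all elements of $[X]^2$ red, or there is a $k$-element $Y\subseteq\beta$ with all elements of $[Y]^2$ blue; the claim includes that such an ordinal exists. *)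

theory Defs
  imports "HOL-Analysis.Elementary_Topology" "HOL-Library.Countable_Set_Type" "HOL-Library.Ramsey"
begin

section \<open>Countable ordinals\<close>

text \<open>
  Ordinals are modelled by the points of the first uncountable ordinal, so that the type below
  consists of exactly the countable ordinals. An ordinal \<open>\<beta>\<close>, seen as the set of smaller ordinals,
  is \<open>{..<\<beta>}\<close>.
\<close>

typedef ordinal = "Field (cardSuc natLeq)"
  using Field_cardSuc_not_empty[OF natLeq_Card_order] by blast

lemma Well_order_cardSuc_natLeq: "Well_order (cardSuc natLeq)"
  using cardSuc_Well_order natLeq_Card_order by blast

instantiation ordinal :: wellorder
begin

definition less_eq_ordinal :: "ordinal \<Rightarrow> ordinal \<Rightarrow> bool" where
  "a \<le> b \<longleftrightarrow> (Rep_ordinal a, Rep_ordinal b) \<in> cardSuc natLeq"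

definition less_ordinal :: "ordinal \<Rightarrow> ordinal \<Rightarrow> bool" where
  "(a :: ordinal) < b \<longleftrightarrow> a \<le> b \<and> a \<noteq> b"

instance
proof -
  let ?P = "cardSuc natLeq :: nat set rel"
  have refl: "refl_on (Field ?P) ?P" and trans: "trans ?P" and antisym: "antisym ?P"
    and total: "total_on (Field ?P) ?P" and wf: "wf (?P - Id)"
    using Well_order_cardSuc_natLeq
    by (auto simp: well_order_on_def linear_order_on_def partial_order_on_def preorder_on_def)
  have le_antisym: "a = b" if "a \<le> b" "b \<le> a" for a b :: ordinal
    using antisymD[OF antisym] that unfolding less_eq_ordinal_def Rep_ordinal_inject[symmetric]
    by metis
  have le_refl: "a \<le> a" for a :: ordinal
    unfolding less_eq_ordinal_def using refl Rep_ordinal by (rule refl_onD)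
  show "OFCLASS(ordinal, wellorder_class)"
  proof
    fix a b c :: ordinal
    show "(a < b) = (a \<le> b \<and> \<not> b \<le> a)"
      unfolding less_ordinal_def using le_antisym le_refl by metis
    show "a \<le> a"
      by (rule le_refl)
    show "a \<le> c" if "a \<le> b" "b \<le> c"
      using transD[OF trans] that unfolding less_eq_ordinal_def by metis
    show "a = b" if "a \<le> b" "b \<le> a"
      using that by (rule le_antisym)
    show "a \<le> b \<or> b \<le> a"
      using total Rep_ordinal[of a] Rep_ordinal[of b] le_refl[of a]
      unfolding less_eq_ordinal_def total_on_def by metis
  next
    fix Q :: "ordinal \<Rightarrow> bool" and a :: ordinal
    assume step: "\<And>x. (\<And>y. y < x \<Longrightarrow> Q y) \<Longrightarrow> Q x"
    have "wf (inv_image (?P - Id) Rep_ordinal)"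
      using wf by (rule wf_inv_image)
    then show "Q a"
    proof (induction rule: wf_induct_rule)
      case (less x)
      show "Q x"
        by (rule step, rule less)
          (auto simp: less_ordinal_def less_eq_ordinal_def Rep_ordinal_inject)
    qed
  qed
qed

end

lemma countable_lessThan_ordinal: "countable {..<a :: ordinal}"
proof -
  include cardinal_syntax
  have "|underS (cardSuc natLeq) (Rep_ordinal a)| <o cardSuc natLeq"
    by (rule card_of_underS[OF cardSuc_Card_order[OF natLeq_Card_order] Rep_ordinal])
  then have "|underS (cardSuc natLeq) (Rep_ordinal a)| \<le>o natLeq"
    by (rule cardSuc_ordLeq_ordLess[OF natLeq_Card_order card_of_Card_order, THEN iffD1])
  then have "countable (underS (cardSuc natLeq) (Rep_ordinal a))"
    by (rule countable_card_le_natLeq[THEN iffD2])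
  moreover have "Rep_ordinal ` {..<a} \<subseteq> underS (cardSuc natLeq) (Rep_ordinal a)"
    unfolding underS_def less_ordinal_def less_eq_ordinal_def lessThan_def Rep_ordinal_inject[symmetric]
    by blast
  ultimately have "countable (Rep_ordinal ` {..<a})"
    by (rule countable_subset[rotated])
  moreover have "inj_on Rep_ordinal {..<a}"
    by (rule inj_onI) (rule Rep_ordinal_inject[THEN iffD1])
  ultimately show ?thesis
    by (rule countable_image_inj_on)
qed

lemma uncountable_ordinals: "uncountable (UNIV :: ordinal set)"
proof
  include cardinal_syntax
  assume "countable (UNIV :: ordinal set)"
  then have "countable (range Rep_ordinal)"
    by (rule countable_image)
  then have "|Field (cardSuc natLeq)| \<le>o natLeq"
    unfolding type_definition.Rep_range[OF type_definition_ordinal] countable_card_le_natLeq .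
  then have "cardSuc natLeq \<le>o natLeq"
    by (rule ordIso_ordLeq_trans[OF ordIso_symmetric
          [OF card_of_Field_ordIso[OF cardSuc_Card_order[OF natLeq_Card_order]]]])
  then show False
    using cardSuc_greater[OF natLeq_Card_order] not_ordLeq_ordLess by metis
qed

lemma bdd_above_countable_ordinals:
  fixes A :: "ordinal set"
  assumes "countable A"
  shows "bdd_above A"
proof (rule ccontr)
  assume "\<not> bdd_above A"
  then have "\<exists>a\<in>A. b < a" for b
    unfolding bdd_above_def by (meson not_le_imp_less)
  then have "UNIV = (\<Union>a\<in>A. {..<a})"
    by auto
  moreover have "countable (\<Union>a\<in>A. {..<a})"
    using assms countable_lessThan_ordinal by blast
  ultimately show False
    using uncountable_ordinals by simp
qed

lemma ex_greater_ordinal: "\<exists>b :: ordinal. a < b"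
proof (rule ccontr)
  assume "\<nexists>b. a < b"
  then have "UNIV = insert a {..<a}"
    using linorder_less_linear[of _ a] by blast
  then show False
    using uncountable_ordinals countable_lessThan_ordinal[of a] by (metis countable_insert)
qed

instantiation ordinal :: conditionally_complete_linorder
begin

definition inf_ordinal :: "ordinal \<Rightarrow> ordinal \<Rightarrow> ordinal" where "inf_ordinal = min"
definition sup_ordinal :: "ordinal \<Rightarrow> ordinal \<Rightarrow> ordinal" where "sup_ordinal = max"
definition Inf_ordinal :: "ordinal set \<Rightarrow> ordinal" where "Inf X = (LEAST a :: ordinal. a \<in> X)"
definition Sup_ordinal :: "ordinal set \<Rightarrow> ordinal" where "Sup X = (LEAST b :: ordinal. \<forall>a\<in>X. a \<le> b)"

instance
proof
  fix a :: ordinal and X :: "ordinal set"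
  show "Inf X \<le> a" if "a \<in> X"
    using that unfolding Inf_ordinal_def by (rule Least_le)
  show "a \<le> Inf X" if "X \<noteq> {}" "\<And>x. x \<in> X \<Longrightarrow> a \<le> x"
    using that unfolding Inf_ordinal_def ex_in_conv[symmetric] by (rule LeastI2_ex)
  show "a \<le> Sup X" if "a \<in> X" "bdd_above X"
  proof -
    have "\<forall>x\<in>X. x \<le> Sup X"
      using \<open>bdd_above X\<close> unfolding Sup_ordinal_def bdd_above_def by (rule LeastI_ex)
    with \<open>a \<in> X\<close> show ?thesis
      by blast
  qed
  show "Sup X \<le> a" if "\<And>x. x \<in> X \<Longrightarrow> x \<le> a"
    unfolding Sup_ordinal_def by (rule Least_le) (use that in blast)
qed (auto simp: inf_ordinal_def sup_ordinal_def)

end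

text \<open>
  The order topology. Since \<open>{..<\<beta>}\<close> is an initial segment, the order topology of \<open>\<beta>\<close> itself is the
  subspace topology on \<open>{..<\<beta>}\<close>.
\<close>

instantiation ordinal :: linorder_topology
begin

definition open_ordinal :: "ordinal set \<Rightarrow> bool" where
  "open_ordinal = generate_topology (range (\<lambda>a. {..<a}) \<union> range (\<lambda>a. {a<..}))"

instance
  by standard (rule open_ordinal_def)

end

section \<open>Ordinal arithmetic\<close>

instantiation ordinal :: zero
begin

definition zero_ordinal :: ordinal where "0 = (LEAST a :: ordinal. True)"

instance ..

end

definition osucc :: "ordinal \<Rightarrow> ordinal" where
  "osucc a = (LEAST b. a < b)"

lemma less_osucc: "a < osucc a"
  unfolding osucc_def by (rule LeastI_ex) (rule ex_greater_ordinal)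

lemma osucc_le_iff: "osucc a \<le> b \<longleftrightarrow> a < b"
proof
  show "a < b" if "osucc a \<le> b"
    using less_osucc that by (rule less_le_trans)
  show "osucc a \<le> b" if "a < b"
    using that unfolding osucc_def by (rule Least_le)
qed

lemma osucc_inject: "osucc a = osucc b \<longleftrightarrow> a = b"
proof
  assume eq: "osucc a = osucc b"
  show "a = b"
  proof (rule linorder_cases[of a b])
    assume "a < b"
    then have "osucc b \<le> b"
      unfolding osucc_le_iff[symmetric] eq .
    then show ?thesis
      unfolding osucc_le_iff by simp
  next
    assume "b < a"
    then have "osucc a \<le> a"
      unfolding osucc_le_iff[symmetric] eq .
    then show ?thesis
      unfolding osucc_le_iff by simp
  qed
qed simp

lemma ordinal_zero_le: "0 \<le> (a :: ordinal)"
  unfolding zero_ordinal_def by (rule Least_le) (rule TrueI)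

lemma osucc_not_zero: "osucc a \<noteq> 0"
  using less_osucc[of a] ordinal_zero_le[of a] by (auto dest: leD)

function ord_rec :: "ordinal \<Rightarrow> (ordinal \<Rightarrow> ordinal) \<Rightarrow> ordinal \<Rightarrow> ordinal" where
  "ord_rec z s b =
    (if b = 0 then z
     else if \<exists>c. b = osucc c then s (ord_rec z s (THE c. b = osucc c))
     else Sup ((\<lambda>c. ord_rec z s c) ` {..<b}))"
  by pat_completeness auto
termination
proof (relation "inv_image {(x, y). x < y} (\<lambda>(z, s, b). b)")
  show "wf (inv_image {(x, y). x < y} (\<lambda>(z :: ordinal, s :: ordinal \<Rightarrow> ordinal, b :: ordinal). b))"
    by (rule wf_inv_image) (rule wf)
qed (auto simp: osucc_inject less_osucc)

declare ord_rec.simps [simp del]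

text \<open>
  The three clauses of transfinite recursion. The supremum in the limit clause is a genuine least
  upper bound because every countable set of countable ordinals is bounded.
\<close>

lemma ord_rec_0: "ord_rec z s 0 = z"
  by (subst ord_rec.simps) simp

lemma ord_rec_osucc: "ord_rec z s (osucc b) = s (ord_rec z s b)"
  by (subst ord_rec.simps) (simp add: osucc_not_zero osucc_inject)

lemma ord_rec_limit:
  assumes "b \<noteq> 0" "\<And>c. b \<noteq> osucc c"
  shows "ord_rec z s b = (SUP c\<in>{..<b}. ord_rec z s c)"
    and "bdd_above (ord_rec z s ` {..<b})"
proof -
  show "ord_rec z s b = (SUP c\<in>{..<b}. ord_rec z s c)"
    using assms by (subst ord_rec.simps) simp
  show "bdd_above (ord_rec z s ` {..<b})"
    by (intro bdd_above_countable_ordinals countable_image countable_lessThan_ordinal)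
qed

instantiation ordinal :: "{one, plus, times}"
begin

definition one_ordinal :: ordinal where "(1 :: ordinal) = osucc 0"
definition plus_ordinal :: "ordinal \<Rightarrow> ordinal \<Rightarrow> ordinal" where "a + b = ord_rec a osucc b"
definition times_ordinal :: "ordinal \<Rightarrow> ordinal \<Rightarrow> ordinal" where "a * b = ord_rec 0 (\<lambda>x. x + a) b"

instance ..

end

text \<open>With base \<open>0\<close> this gives the value \<open>1\<close> at limit exponents; for bases at least \<open>1\<close> it is
  the usual ordinal power.\<close>

definition oexp :: "ordinal \<Rightarrow> ordinal \<Rightarrow> ordinal" (infixr \<open>\<up>\<close> 80) where
  "a \<up> b = ord_rec 1 (\<lambda>x. x * a) b"

definition ord_of_nat :: "nat \<Rightarrow> ordinal" where
  "ord_of_nat n = (osucc ^^ n) 0"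

definition omega :: ordinal (\<open>\<omega>\<close>) where
  "\<omega> = (SUP n. ord_of_nat n)"

section \<open>Closed Ramsey numbers\<close>

definition closed_copy :: "ordinal set \<Rightarrow> ordinal \<Rightarrow> bool" where
  "closed_copy X \<alpha> \<longleftrightarrow> (\<exists>f g. strict_mono_on X f \<and> homeomorphism X {..<\<alpha>} f g)"

datatype colour = Red | Blue

text \<open>
  Colourings are total functions on sets of ordinals; only their values on the two-element
  subsets of \<open>\<beta>\<close> matter.
\<close>

definition closed_arrow :: "ordinal \<Rightarrow> ordinal \<Rightarrow> nat \<Rightarrow> bool" where
  "closed_arrow \<beta> \<alpha> k \<longleftrightarrow>
    (\<forall>c :: ordinal set \<Rightarrow> colour.
      (\<exists>X. X \<subseteq> {..<\<beta>} \<and> closed_copy X \<alpha> \<and> (\<forall>e\<in>[X]\<^bsup>2\<^esup>. c e = Red)) \<or>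
      (\<exists>Y. Y \<in> [{..<\<beta>}]\<^bsup>k\<^esup> \<and> (\<forall>e\<in>[Y]\<^bsup>2\<^esup>. c e = Blue)))"

text \<open>
  The value is meaningful only if some \<open>\<beta>\<close> satisfies the arrow relation. If some countable one
  does, the least ordinal doing so is countable as well, so nothing is lost by taking the
  minimum over countable ordinals.
\<close>

definition Rcl :: "ordinal \<Rightarrow> nat \<Rightarrow> ordinal" where
  "Rcl \<alpha> k = (LEAST \<beta>. closed_arrow \<beta> \<alpha> k)"

end

theory Submission
  imports Defs
begin

text \<open>
  View the ordinals from \<open>1\<close> to \<open>\<omega>\<^sup>n\<close> as a tree of height \<open>n\<close> in which every inner node has \<open>\<omega>\<close>
  children: a node is a list of at most \<open>n\<close> natural numbers, and an inner node is placed at the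
  supremum of its children, so that the ordinals list the tree in post-order. An inner node is then the
  limit of any sequence of descendants passing through infinitely many different children.

  Fix a colouring of this tree for which there is no blue clique on \<open>k + 1\<close> points. Two nodes can be
  written as \<open>w @ p @ p'\<close> and \<open>w @ r\<close>, and if the coordinates interleave as in the increasing
  list \<open>w @ p @ r @ p'\<close>, the colour of the pair is a colouring of finite sets of natural numbers. The
  infinite Ramsey theorem thins out the coordinates so that the colour depends only on the four
  lengths (\<open>uniform_tree_colouring\<close>). A quadruple of lengths must then be red as soon as there are
  \<open>k + 1\<close> nodes all of whose pairs have that pattern. This is the case for two nodes of equal depth, where the coordinates of the nodes are nested like brackets
  (\<open>nested_red\<close>). For an ancestor and its descendant, or for a node followed by an entirely later,
  deeper one, the available cliques use nodes of many different depths, so that these patterns need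
  not be red at every depth; but the finite Ramsey theorem, applied to pairs and triples of depths,
  yields \<open>m + 1\<close> depths at which they are all red, provided that \<open>n\<close> is large
  (\<open>ex_depth_ramsey\<close>).

  At these depths the red copy of \<open>\<omega> \<cdot> m + 1\<close> can be written down (\<open>red_configuration\<close>): its limit
  points \<open>x\<^sub>1 < \<dots> < x\<^sub>m\<close> lie on one branch, each an ancestor of the preceding one, the least point
  lies further down that branch, and \<open>x\<^sub>j\<close> is the limit of descendants of maximal depth whose further
  coordinates are blocks of consecutive numbers. All blocks are disjoint, so every pair of points shows
  one of the patterns above. The bound is a single power of \<open>\<omega>\<close> and hence below \<open>\<omega>\<^sup>\<omega>\<close>.
\<close>

section \<open>Sums and powers of omega\<close>

lemma bdd_above_range_ordinals [simp]:
  fixes t :: "nat \<Rightarrow> ordinal"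
  shows "bdd_above (range t)"
  by (intro bdd_above_countable_ordinals) simp

lemma less_SUP_nat_iff:
  fixes t :: "nat \<Rightarrow> ordinal"
  shows "b < (SUP j. t j) \<longleftrightarrow> (\<exists>j. b < t j)"
  by (subst less_cSUP_iff) auto

lemma SUP_nat_upper:
  fixes t :: "nat \<Rightarrow> ordinal"
  shows "t j \<le> (SUP j. t j)"
  by (rule cSUP_upper) auto

lemma less_osucc_iff: "a < osucc b \<longleftrightarrow> a \<le> b"
  by (metis linorder_not_le osucc_le_iff)

lemma ord_add_0: "a + 0 = (a :: ordinal)"
  by (simp add: plus_ordinal_def ord_rec_0)

lemma ord_add_osucc: "a + osucc b = osucc (a + b)"
  by (simp add: plus_ordinal_def ord_rec_osucc)

lemma ord_add_1: "a + 1 = osucc a"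
  by (simp add: one_ordinal_def ord_add_osucc ord_add_0)

lemma ord_add_limit:
  fixes a b :: ordinal
  assumes "b \<noteq> 0" "\<And>c. b \<noteq> osucc c"
  shows "a + b = (SUP c\<in>{..<b}. a + c)" and "bdd_above ((+) a ` {..<b})"
  using ord_rec_limit[OF assms, of a osucc] by (simp_all add: plus_ordinal_def)

lemma ord_add_strict_mono:
  fixes a b c :: ordinal
  assumes "b < c"
  shows "a + b < a + c"
  using assms
proof (induction c rule: less_induct)
  case (less c)
  consider d where "c = osucc d" | "c \<noteq> 0" "\<And>d. c \<noteq> osucc d"
    using less.prems ordinal_zero_le[of b] by fastforce
  then show ?case
  proof cases
    case 1
    then have "b = d \<or> b < d"
      using less.prems osucc_le_iff[of d b] by force
    then show ?thesis
      using less.IH[of d] 1 less_osucc[of d] less_osucc[of "a + d"]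
      by (auto simp: ord_add_osucc intro: less_trans)
  next
    case 2
    have "osucc b < c"
      using less.prems 2(2)[of b] osucc_le_iff[of b c] by (simp add: order.strict_iff_order)
    then have "a + osucc b \<le> a + c"
      unfolding ord_add_limit(1)[OF 2] by (intro cSUP_upper ord_add_limit(2)[OF 2]) simp
    then show ?thesis
      by (simp add: ord_add_osucc osucc_le_iff)
  qed
qed

lemma strict_mono_SUP_not_osucc:
  fixes t :: "nat \<Rightarrow> ordinal"
  assumes "strict_mono t"
  shows "(SUP j. t j) \<noteq> 0" and "(SUP j. t j) \<noteq> osucc c" and "t j < (SUP j. t j)"
proof -
  show less: "t j < (SUP j. t j)" for j
    using assms by (auto simp: less_SUP_nat_iff strict_mono_def intro: exI[of _ "Suc j"])
  show "(SUP j. t j) \<noteq> 0"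
    using less[of 0] ordinal_zero_le[of "t 0"] by fastforce
  show "(SUP j. t j) \<noteq> osucc c"
  proof
    assume eq: "(SUP j. t j) = osucc c"
    then obtain j where "c < t j"
      using less_SUP_nat_iff[of c t] less_osucc[of c] by auto
    then show False
      using less[of j] by (simp add: eq less_osucc_iff)
  qed
qed

lemma ord_add_SUP:
  fixes t :: "nat \<Rightarrow> ordinal"
  assumes "strict_mono t"
  shows "a + (SUP j. t j) = (SUP j. a + t j)"
proof -
  note lim = strict_mono_SUP_not_osucc[OF assms]
  have "x < a + (SUP j. t j) \<longleftrightarrow> x < (SUP j. a + t j)" for x
  proof -
    have ne: "{..<(SUP j. t j)} \<noteq> {}"
      using lim(3) by blast
    have "x < a + (SUP j. t j) \<longleftrightarrow> (\<exists>c<(SUP j. t j). x < a + c)"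
      unfolding ord_add_limit(1)[OF lim(1,2)]
      by (subst less_cSUP_iff[OF ne ord_add_limit(2)[OF lim(1,2)]]) auto
    also have "\<dots> \<longleftrightarrow> (\<exists>j. x < a + t j)"
    proof
      assume "\<exists>c<(SUP j. t j). x < a + c"
      then show "\<exists>j. x < a + t j"
        using ord_add_strict_mono[of _ _ a] unfolding less_SUP_nat_iff by (metis less_trans)
    qed (use lim(3) in blast)
    finally show ?thesis
      by (simp add: less_SUP_nat_iff)
  qed
  then show ?thesis
    by (metis linorder_neqE order_less_irrefl)
qed

lemma strict_mono_osucc_iterates: "strict_mono (\<lambda>j. (osucc ^^ j) a)"
  by (simp add: strict_mono_Suc_iff less_osucc)

lemma less_SUP_osucc_iterates:
  "b < (SUP j. (osucc ^^ j) a) \<longleftrightarrow> b < a \<or> (\<exists>j. b = (osucc ^^ j) a)"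
proof
  assume "b < (SUP j. (osucc ^^ j) a)"
  then obtain j where "b < (osucc ^^ j) a"
    by (auto simp: less_SUP_nat_iff)
  then show "b < a \<or> (\<exists>j. b = (osucc ^^ j) a)"
  proof (induction j)
    case (Suc j)
    then have "b \<le> (osucc ^^ j) a"
      by (simp add: less_osucc_iff)
    then show ?case
      using Suc.IH by (cases "b = (osucc ^^ j) a") auto
  qed simp
next
  have "(osucc ^^ j) a < (SUP j. (osucc ^^ j) a)" for j
    by (rule strict_mono_SUP_not_osucc(3)[OF strict_mono_osucc_iterates])
  moreover from this[of 0] have "a < (SUP j. (osucc ^^ j) a)"
    by simp
  ultimately show "b < (SUP j. (osucc ^^ j) a)" if "b < a \<or> (\<exists>j. b = (osucc ^^ j) a)"
    using that by (auto intro: less_trans)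
qed

lemma less_omega_iff: "b < \<omega> \<longleftrightarrow> (\<exists>n. b = ord_of_nat n)"
  using less_SUP_osucc_iterates[of b 0] ordinal_zero_le[of b]
  by (auto simp: omega_def ord_of_nat_def)

lemma ord_rec_ord_of_nat: "ord_rec z s (ord_of_nat n) = (s ^^ n) z"
  by (induction n) (simp_all add: ord_of_nat_def ord_rec_0 ord_rec_osucc)

lemma ord_rec_omega: "ord_rec z s \<omega> = (SUP n. (s ^^ n) z)"
proof -
  have "{..<\<omega>} = range ord_of_nat"
    by (auto simp: less_omega_iff)
  moreover have "ord_rec z s \<omega> = (SUP c\<in>{..<\<omega>}. ord_rec z s c)"
    using strict_mono_SUP_not_osucc(1,2)[OF strict_mono_osucc_iterates, of 0]
    by (intro ord_rec_limit(1)) (simp_all add: omega_def ord_of_nat_def)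
  ultimately show ?thesis
    by (simp add: image_image ord_rec_ord_of_nat)
qed

text \<open>
  The ordinal \<open>a + \<omega>\<^sup>n\<close>, computed by recursion on \<open>n\<close> without mentioning powers: adding \<open>\<omega>\<^sup>n\<^sup>+\<^sup>1\<close> means
  adding \<open>\<omega>\<^sup>n\<close> infinitely often. This is the form in which the tree below is built.
\<close>

primrec add_power :: "nat \<Rightarrow> ordinal \<Rightarrow> ordinal" where
  "add_power 0 a = osucc a"
| "add_power (Suc n) a = (SUP j. (add_power n ^^ j) a)"

lemma less_add_power: "a < add_power n a"
proof (induction n arbitrary: a)
  case (Suc n)
  have "(add_power n ^^ 1) a \<le> add_power (Suc n) a"
    unfolding add_power.simps by (rule SUP_nat_upper)
  then show ?case
    using Suc[of a] by simp
qed (simp add: less_osucc)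

lemma strict_mono_add_power_iterates: "strict_mono (\<lambda>j. (add_power n ^^ j) a)"
  by (simp add: strict_mono_Suc_iff less_add_power)

text \<open>
  An instance of associativity, \<open>a + (b + \<omega>\<^sup>n) = (a + b) + \<omega>\<^sup>n\<close>, proved by pushing \<open>a +\<close> through
  the suprema that define \<open>add_power\<close>.
\<close>

lemma ord_add_add_power: "a + add_power n b = add_power n (a + b)"
proof (induction n arbitrary: b)
  case 0
  then show ?case by (simp add: ord_add_osucc)
next
  case (Suc n)
  have "a + (add_power n ^^ j) b = (add_power n ^^ j) (a + b)" for j
    by (induction j) (simp_all add: Suc)
  then show ?case
    by (simp add: ord_add_SUP[OF strict_mono_add_power_iterates])
qed

lemma omega_power_eq: "\<omega> \<up> ord_of_nat n = add_power n 0"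
proof (induction n)
  case 0
  then show ?case
    by (simp add: oexp_def ord_rec_ord_of_nat one_ordinal_def)
next
  case (Suc n)
  have "\<omega> \<up> ord_of_nat (Suc n) = add_power n 0 * \<omega>"
    using Suc by (simp add: oexp_def ord_rec_ord_of_nat)
  also have "\<dots> = (SUP j. ((\<lambda>x. x + add_power n 0) ^^ j) 0)"
    by (simp add: times_ordinal_def ord_rec_omega)
  also have "(\<lambda>x. x + add_power n 0) = add_power n"
    by (simp add: ord_add_add_power ord_add_0)
  finally show ?case by simp
qed

lemma add_power_less_omega_omega: "add_power n 0 < \<omega> \<up> \<omega>"
proof -
  have eq: "\<omega> \<up> \<omega> = (SUP n. add_power n 0)"
    using omega_power_eq by (simp add: oexp_def ord_rec_omega ord_rec_ord_of_nat)
  have "(add_power n ^^ 2) 0 \<le> add_power (Suc n) 0"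
    unfolding add_power.simps by (rule SUP_nat_upper)
  then have "add_power n 0 < add_power (Suc n) 0"
    using less_add_power[of "add_power n 0" n] by (simp add: numeral_2_eq_2)
  then show ?thesis
    unfolding eq less_SUP_nat_iff by blast
qed

text \<open>
  Since \<open>\<omega> \<cdot> (m + 1) = \<omega> \<cdot> m + \<omega>\<close>, the next multiple of \<open>\<omega>\<close> is reached by iterated successors.
\<close>

lemma omega_mult_Suc: "\<omega> * ord_of_nat (Suc m) = (SUP j. (osucc ^^ j) (\<omega> * ord_of_nat m))"
  by (simp add: times_ordinal_def ord_rec_ord_of_nat plus_ordinal_def ord_rec_omega)

section \<open>The tree of a power of omega\<close>

text \<open>
  The order on the nodes is post-order, with siblings increasing and a node above its descendants. The
  last condition is continuity at the inner nodes: descendants through late children approach the node,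
  however deep they lie.
\<close>

locale tree_embedding =
  fixes n :: nat and \<phi> :: "nat list \<Rightarrow> 'a::linorder"
  assumes less_sibling: "\<lbrakk>i < j; length (w @ i # p) \<le> n; length (w @ j # q) \<le> n\<rbrakk> \<Longrightarrow>
      \<phi> (w @ i # p) < \<phi> (w @ j # q)"
    and less_ancestor: "length (w @ i # p) \<le> n \<Longrightarrow> \<phi> (w @ i # p) < \<phi> w"
    and descendants_cofinal: "\<lbrakk>y < \<phi> w; length w < n\<rbrakk> \<Longrightarrow>
      \<exists>J. \<forall>j\<ge>J. \<forall>p. length (w @ j # p) \<le> n \<longrightarrow> y < \<phi> (w @ j # p)"

text \<open>
  The tree of height \<open>n\<close> is placed on the interval from \<open>a\<close> (excluded) to \<open>a + \<omega>\<^sup>n\<close>, and the subtree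
  at child \<open>j\<close> of the root is the tree of height \<open>n - 1\<close> on the \<open>j\<close>-th of the \<open>\<omega>\<close> consecutive
  intervals of type \<open>\<omega>\<^sup>n\<^sup>-\<^sup>1\<close>.
\<close>

fun tree_point :: "nat \<Rightarrow> ordinal \<Rightarrow> nat list \<Rightarrow> ordinal" where
  "tree_point n a [] = add_power n a"
| "tree_point n a (j # s) = tree_point (n - 1) ((add_power (n - 1) ^^ j) a) s"

lemma tree_point_bounds:
  "length s \<le> n \<Longrightarrow> a < tree_point n a s \<and> tree_point n a s \<le> add_power n a \<and>
    (s \<noteq> [] \<longrightarrow> tree_point n a s < add_power n a)"
proof (induction s arbitrary: n a)
  case (Cons j s)
  from Cons.prems obtain n' where n: "n = Suc n'"
    by (cases n) auto
  let ?a = "(add_power n' ^^ j) a"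
  have "length s \<le> n'"
    using Cons.prems n by simp
  then have *: "?a < tree_point n' ?a s" "tree_point n' ?a s \<le> add_power n' ?a"
    using Cons.IH by blast+
  have "a \<le> ?a"
    using strict_mono_less_eq[OF strict_mono_add_power_iterates[of n' a], of 0 j] by simp
  moreover have "add_power n' ?a < add_power (Suc n') a"
    using strict_mono_SUP_not_osucc(3)[OF strict_mono_add_power_iterates[of n' a], of "Suc j"] by simp
  ultimately show ?case
    using * by (auto simp: n)
qed (auto simp: less_add_power)

lemma tree_embedding_tree_point: "tree_embedding n (tree_point n a)"
proof
  fix i j :: nat and w p q
  assume "i < j" "length (w @ i # p) \<le> n" "length (w @ j # q) \<le> n"
  then show "tree_point n a (w @ i # p) < tree_point n a (w @ j # q)"
  proof (induction w arbitrary: n a)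
    case Nil
    then obtain n' where n: "n = Suc n'"
      by (cases n) auto
    have "tree_point n' ((add_power n' ^^ i) a) p \<le> (add_power n' ^^ Suc i) a"
      using tree_point_bounds[of p n'] Nil n by simp
    also have "\<dots> \<le> (add_power n' ^^ j) a"
      using \<open>i < j\<close> strict_mono_less_eq[OF strict_mono_add_power_iterates] by (meson Suc_leI)
    also have "\<dots> < tree_point n' ((add_power n' ^^ j) a) q"
      using tree_point_bounds[of q n'] Nil n by simp
    finally show ?case by (simp add: n)
  qed auto
next
  fix i :: nat and w p
  assume "length (w @ i # p) \<le> n"
  then show "tree_point n a (w @ i # p) < tree_point n a w"
  proof (induction w arbitrary: n a)
    case Nil
    then show ?case
      using tree_point_bounds[of "i # p" n a] by simp
  qed auto
next
  fix y :: ordinal and w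
  assume "y < tree_point n a w" "length w < n"
  then show "\<exists>J. \<forall>j\<ge>J. \<forall>p. length (w @ j # p) \<le> n \<longrightarrow> y < tree_point n a (w @ j # p)"
  proof (induction w arbitrary: n a)
    case Nil
    then obtain n' where n: "n = Suc n'"
      by (cases n) auto
    then obtain J where J: "y < (add_power n' ^^ J) a"
      using Nil by (auto simp: less_SUP_nat_iff)
    have "y < tree_point n' ((add_power n' ^^ j) a) p" if "J \<le> j" "length p \<le> n'" for j p
    proof -
      have "(add_power n' ^^ J) a \<le> (add_power n' ^^ j) a"
        using that strict_mono_less_eq[OF strict_mono_add_power_iterates] by blast
      then show ?thesis
        using J tree_point_bounds[OF that(2)] by (meson less_trans order.strict_trans2)
    qed
    then show ?case by (auto simp: n)
  next
    case (Cons i w)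
    then obtain n' where n: "n = Suc n'"
      by (cases n) auto
    then show ?case
      using Cons.IH[of n' "(add_power n' ^^ i) a"] Cons.prems by auto
  qed
qed

text \<open>
  Thinning out the coordinates preserves the embedding, and continuity survives because a strictly
  increasing sequence of natural numbers is unbounded.
\<close>

lemma tree_embedding_comp_map:
  assumes "tree_embedding n \<phi>" and "strict_mono e"
  shows "tree_embedding n (\<phi> \<circ> map e)"
proof -
  interpret tree_embedding n \<phi> by fact
  show ?thesis
  proof
    fix i j :: nat and w p q
    assume "i < j" "length (w @ i # p) \<le> n" "length (w @ j # q) \<le> n"
    then show "(\<phi> \<circ> map e) (w @ i # p) < (\<phi> \<circ> map e) (w @ j # q)"
      using less_sibling[of "e i" "e j" "map e w" "map e p" "map e q"] \<open>strict_mono e\<close>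
      by (simp add: strict_mono_def)
  next
    fix i :: nat and w p
    assume "length (w @ i # p) \<le> n"
    then show "(\<phi> \<circ> map e) (w @ i # p) < (\<phi> \<circ> map e) w"
      using less_ancestor[of "map e w" "e i" "map e p"] by simp
  next
    fix y and w
    assume "y < (\<phi> \<circ> map e) w" "length w < n"
    then obtain J where J: "\<And>j p. \<lbrakk>J \<le> j; length (map e w @ j # p) \<le> n\<rbrakk> \<Longrightarrow> y < \<phi> (map e w @ j # p)"
      using descendants_cofinal[of y "map e w"] by auto
    have "y < (\<phi> \<circ> map e) (w @ j # p)" if "J \<le> j" "length (w @ j # p) \<le> n" for j p
      using J[of "e j" "map e p"] that strict_mono_imp_increasing[OF \<open>strict_mono e\<close>, of j]
      by simp
    then show "\<exists>J. \<forall>j\<ge>J. \<forall>p. length (w @ j # p) \<le> n \<longrightarrow> y < (\<phi> \<circ> map e) (w @ j # p)"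
      by blast
  qed
qed

section \<open>Ladders and closed copies\<close>

text \<open>
  An order isomorphism from an ordinal onto a set of ordinals always has a continuous inverse, since the
  rays that generate the order topology correspond to rays. Preimages of lower rays under \<open>g\<close> itself
  are initial segments, hence open; only upper rays require continuity at limits.
\<close>

lemma closed_copy_image:
  assumes mono: "strict_mono_on {..<\<alpha>} g"
    and cont: "\<And>c y. \<lbrakk>c < \<alpha>; c \<noteq> 0; \<And>d. c \<noteq> osucc d; y < g c\<rbrakk> \<Longrightarrow> \<exists>d<c. y < g d"
  shows "closed_copy (g ` {..<\<alpha>}) \<alpha>"
proof -
  let ?X = "g ` {..<\<alpha>}" and ?f = "the_inv_into {..<\<alpha>} g"
  have inj: "inj_on g {..<\<alpha>}"
    using mono by (rule strict_mono_on_imp_inj_on)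
  have fg: "?f (g b) = b" if "b < \<alpha>" for b
    using the_inv_into_f_f[OF inj] that by simp
  have less: "g b < g d \<longleftrightarrow> b < d" if "b < \<alpha>" "d < \<alpha>" for b d
    using that mono by (metis lessThan_iff linorder_neqE order_less_asym strict_mono_onD)
  have "strict_mono_on ?X ?f"
    by (rule strict_mono_onI) (auto simp: fg less)
  moreover have "homeomorphism ?X {..<\<alpha>} ?f g"
  proof
    show "continuous_on ?X ?f"
    proof (rule continuous_on_generate_topology[OF open_generated_order], safe)
      fix y
      have "(if y < \<alpha> then {..<g y} else UNIV) \<inter> ?X = ?f -` {..<y} \<inter> ?X"
        by (auto simp: fg less)
      then show "\<exists>C. open C \<and> C \<inter> ?X = ?f -` {..<y} \<inter> ?X"
        by (metis open_UNIV open_lessThan)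
      have "(if y < \<alpha> then {g y<..} else {}) \<inter> ?X = ?f -` {y<..} \<inter> ?X"
        by (auto simp: fg less)
      then show "\<exists>C. open C \<and> C \<inter> ?X = ?f -` {y<..} \<inter> ?X"
        by (metis open_empty open_greaterThan)
    qed
    show "continuous_on {..<\<alpha>} g"
    proof (rule continuous_on_generate_topology[OF open_generated_order], safe)
      fix y
      show "\<exists>C. open C \<and> C \<inter> {..<\<alpha>} = g -` {..<y} \<inter> {..<\<alpha>}"
      proof (cases "\<exists>b<\<alpha>. y \<le> g b")
        case True
        define b where "b = (LEAST b. b < \<alpha> \<and> y \<le> g b)"
        have b: "b < \<alpha>" "y \<le> g b"
          using LeastI_ex[OF True[unfolded Bex_def]] by (simp_all add: b_def)
        have "g d < y" if "d < b" for d
          using not_less_Least[OF that[unfolded b_def]] that b(1) by auto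
        then have "{..<b} \<inter> {..<\<alpha>} = g -` {..<y} \<inter> {..<\<alpha>}"
          using b less[of _ b] by (auto simp: not_less[symmetric] dest: order.strict_trans2)
        then show ?thesis by (metis open_lessThan)
      next
        case False
        then have "UNIV \<inter> {..<\<alpha>} = g -` {..<y} \<inter> {..<\<alpha>}"
          by (auto simp: not_le)
        then show ?thesis by (metis open_UNIV)
      qed
      show "\<exists>C. open C \<and> C \<inter> {..<\<alpha>} = g -` {y<..} \<inter> {..<\<alpha>}"
      proof (cases "\<exists>b<\<alpha>. y < g b")
        case True
        define b where "b = (LEAST b. b < \<alpha> \<and> y < g b)"
        have b: "b < \<alpha>" "y < g b"
          using LeastI_ex[OF True[unfolded Bex_def]] by (simp_all add: b_def)
        have below: "g d \<le> y" if "d < b" for d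
          using not_less_Least[OF that[unfolded b_def]] that b(1) by auto
        have "y < g d \<longleftrightarrow> b \<le> d" if "d < \<alpha>" for d
          using b below[of d] less[OF b(1) that] by (cases d b rule: linorder_cases) auto
        then have eq: "{b..} \<inter> {..<\<alpha>} = g -` {y<..} \<inter> {..<\<alpha>}"
          by auto
        \<comment> \<open>Continuity at limits prevents the least point of the preimage from being one.\<close>
        have "b = 0 \<or> (\<exists>d. b = osucc d)"
          using cont[OF b(1) _ _ b(2)] below by (meson leD)
        then have "open {b..}"
        proof
          assume "b = 0"
          then have "{b..} = UNIV"
            using ordinal_zero_le by auto
          then show ?thesis by simp
        next
          assume "\<exists>d. b = osucc d"
          then obtain d where "{b..} = {d<..}"
            using osucc_le_iff by auto
          then show ?thesis by simp
        qed
        with eq show ?thesis by metis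
      next
        case False
        then have "{} \<inter> {..<\<alpha>} = g -` {y<..} \<inter> {..<\<alpha>}"
          by auto
        then show ?thesis by (metis open_empty)
      qed
    qed
  qed (auto simp: fg)
  ultimately show ?thesis
    unfolding closed_copy_def by blast
qed

text \<open>
  The points strictly between two consecutive multiples of \<open>\<omega>\<close> form a sequence of successors. This
  allows a map on \<open>\<omega> \<cdot> m + 1\<close> to be extended to \<open>\<omega> \<cdot> (m + 1) + 1\<close> without checking
  any further limit except the last point.
\<close>

lemma omega_mult_Suc_segment:
  "\<exists>s :: nat \<Rightarrow> ordinal. strict_mono s \<and>
    (\<forall>j. \<omega> * ord_of_nat m < s j \<and> s j < \<omega> * ord_of_nat (Suc m) \<and> (\<exists>d. s j = osucc d)) \<and>
    (\<forall>c. \<omega> * ord_of_nat m < c \<and> c < \<omega> * ord_of_nat (Suc m) \<longrightarrow> (\<exists>j. c = s j))"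
proof -
  define a where "a = \<omega> * ord_of_nat m"
  define s where "s j = (osucc ^^ Suc j) a" for j
  have eq: "\<omega> * ord_of_nat (Suc m) = (SUP j. (osucc ^^ j) a)"
    unfolding a_def by (rule omega_mult_Suc)
  note mono = strict_mono_osucc_iterates[of a]
  show ?thesis
    unfolding a_def[symmetric]
  proof (intro exI[of _ s] conjI allI impI; (elim conjE)?)
    show "strict_mono s"
      unfolding s_def by (intro strict_monoI strict_monoD[OF mono]) simp
    show "a < s j" for j
      unfolding s_def using strict_monoD[OF mono, of 0 "Suc j"] by simp
    show "s j < \<omega> * ord_of_nat (Suc m)" for j
      unfolding s_def eq by (rule strict_mono_SUP_not_osucc(3)[OF mono])
    show "\<exists>d. s j = osucc d" for j
      by (auto simp: s_def)
    show "\<exists>j. c = s j" if c: "a < c" "c < \<omega> * ord_of_nat (Suc m)" for c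
    proof -
      obtain j where j: "c = (osucc ^^ j) a"
        using c(2) order.asym[OF c(1)] unfolding eq less_SUP_osucc_iterates by blast
      with c(1) have "j \<noteq> 0"
        by (intro notI) simp
      then show ?thesis
        using j by (auto simp: s_def gr0_conv_Suc)
    qed
  qed
qed

text \<open>
  The shape of a closed copy of \<open>\<omega> \<cdot> m + 1\<close>: the point \<open>x 0\<close> is the least one, and \<open>x (Suc j)\<close> is the
  limit of the sequence \<open>A j\<close>, which starts above \<open>x j\<close>.
\<close>

definition omega_ladder :: "nat \<Rightarrow> (nat \<Rightarrow> 'a) \<Rightarrow> (nat \<Rightarrow> nat \<Rightarrow> 'a :: linorder) \<Rightarrow> bool" where
  "omega_ladder m x A \<longleftrightarrow> (\<forall>j<m. strict_mono (A j) \<and> x j < A j 0 \<and>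
    (\<forall>t. A j t < x (Suc j)) \<and> (\<forall>y<x (Suc j). \<exists>t. y < A j t))"

definition ladder_points :: "nat \<Rightarrow> (nat \<Rightarrow> 'a) \<Rightarrow> (nat \<Rightarrow> nat \<Rightarrow> 'a) \<Rightarrow> 'a set" where
  "ladder_points m x A = x ` {..m} \<union> (\<Union>j<m. range (A j))"

text \<open>
  The points of the sequence \<open>A j\<close> have to sit at the successors above \<open>\<omega> \<cdot> j\<close>, and \<open>x (Suc j)\<close> at the next
  multiple of \<open>\<omega>\<close>, so the isomorphism is built by induction on \<open>m\<close>, one multiple at a time. The
  induction hypothesis records continuity at all limits up to \<open>\<omega> \<cdot> m\<close>.
\<close>

lemma closed_copy_in_ladder:
  fixes x :: "nat \<Rightarrow> ordinal" and A :: "nat \<Rightarrow> nat \<Rightarrow> ordinal"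
  assumes "omega_ladder m x A"
  shows "\<exists>X \<subseteq> ladder_points m x A. closed_copy X (\<omega> * ord_of_nat m + 1)"
proof -
  have "\<exists>g. strict_mono_on {..\<omega> * ord_of_nat m} g \<and> g (\<omega> * ord_of_nat m) = x m \<and>
      (\<forall>c\<le>\<omega> * ord_of_nat m. c \<noteq> 0 \<longrightarrow> (\<forall>d. c \<noteq> osucc d) \<longrightarrow> (\<forall>y<g c. \<exists>d<c. y < g d)) \<and>
      g ` {..\<omega> * ord_of_nat m} \<subseteq> ladder_points m x A"
    using assms
  proof (induction m)
    case 0
    have "\<omega> * ord_of_nat 0 = 0"
      by (simp add: ord_of_nat_def times_ordinal_def ord_rec_0)
    moreover have "c = 0" if "c \<le> 0" for c :: ordinal
      using that ordinal_zero_le[of c] by simp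
    ultimately show ?case
      by (intro exI[of _ "\<lambda>_. x 0"]) (auto simp: strict_mono_on_def ladder_points_def)
  next
    case (Suc m)
    have A: "strict_mono (A m)" "x m < A m 0" "\<And>t. A m t < x (Suc m)"
      and lim: "\<And>y. y < x (Suc m) \<Longrightarrow> \<exists>t. y < A m t"
      using Suc.prems by (simp_all add: omega_ladder_def)
    define a where "a = \<omega> * ord_of_nat m"
    define b where "b = \<omega> * ord_of_nat (Suc m)"
    have "\<exists>g. strict_mono_on {..a} g \<and> g a = x m \<and>
        (\<forall>c\<le>a. c \<noteq> 0 \<longrightarrow> (\<forall>d. c \<noteq> osucc d) \<longrightarrow> (\<forall>y<g c. \<exists>d<c. y < g d)) \<and>
        g ` {..a} \<subseteq> ladder_points m x A"
      unfolding a_def by (rule Suc.IH) (use Suc.prems in \<open>simp add: omega_ladder_def\<close>)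
    then obtain g where g: "strict_mono_on {..a} g" "g a = x m"
      "\<forall>c\<le>a. c \<noteq> 0 \<longrightarrow> (\<forall>d. c \<noteq> osucc d) \<longrightarrow> (\<forall>y<g c. \<exists>d<c. y < g d)"
      "g ` {..a} \<subseteq> ladder_points m x A"
      by (elim exE conjE) (rule that; assumption)
    obtain s :: "nat \<Rightarrow> ordinal" where s: "strict_mono s"
      and s_segment: "\<forall>j. a < s j \<and> s j < b \<and> (\<exists>d. s j = osucc d)"
      and s_onto: "\<forall>c. a < c \<and> c < b \<longrightarrow> (\<exists>j. c = s j)"
      using omega_mult_Suc_segment[of m, folded a_def b_def] by blast
    have a_less: "a < s j" and s_b: "s j < b" and s_osucc: "\<exists>d. s j = osucc d" for j
      using s_segment by blast+
    have a_b: "a < b"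
      using a_less s_b by (rule less_trans)
    define h where "h c = (if c \<le> a then g c else if c < b then A m (inv s c) else x (Suc m))" for c
    have h_s: "h (s j) = A m j" for j
      using a_less[of j] s_b[of j] inv_f_f[OF strict_mono_imp_inj_on[OF s], of j]
      by (auto simp: h_def dest: leD)
    have h_b: "h b = x (Suc m)"
      using a_b by (auto simp: h_def dest: leD)
    have h_a: "h c = g c" if "c \<le> a" for c
      using that by (simp add: h_def)
    have cases: "c \<le> a \<or> (\<exists>j. c = s j) \<or> c = b" if "c \<le> b" for c
      using that s_onto[rule_format, of c] by (metis leI order.order_iff_strict)
    have g_le: "g c \<le> x m" if "c \<le> a" for c
      using that g(1,2) by (metis atMost_iff order_refl strict_mono_on_leD)
    have g_A: "g c < A m j" if "c \<le> a" for c j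
    proof -
      have "A m 0 \<le> A m j"
        using A(1) by (simp add: strict_mono_less_eq)
      with g_le[OF that] A(2) show ?thesis
        by auto
    qed
    have "strict_mono_on {..b} h"
    proof (rule strict_mono_onI)
      fix c d assume cd: "c \<in> {..b}" "d \<in> {..b}" "c < d"
      from cases[of c] cases[of d] cd consider
        "c \<le> a" "d \<le> a" | j where "c \<le> a" "d = s j" | "c \<le> a" "d = b"
        | i where "c = s i" "d \<le> a"
        | i j where "c = s i" "d = s j" | i where "c = s i" "d = b" | "c = b"
        by auto
      then show "h c < h d"
      proof cases
        case 1
        then show ?thesis using g(1) \<open>c < d\<close> by (simp add: h_a strict_mono_onD)
      next
        case 2
        then show ?thesis using g_A by (simp only: h_a h_s)
      next
        case 3
        then show ?thesis
          using g_A[of c 0] A(3)[of 0] by (simp add: h_a h_b)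
      next
        case 4
        then show ?thesis using a_less[of i] \<open>c < d\<close> by (meson leD less_trans)
      next
        case 5
        then have "i < j" using \<open>c < d\<close> by (simp add: strict_mono_less[OF s])
        then have "A m i < A m j" using A(1) by (simp add: strict_mono_less)
        then show ?thesis using 5 by (simp only: h_s)
      next
        case 6
        have "A m i < x (Suc m)" using A(3) by simp
        then show ?thesis using 6 by (simp only: h_s h_b)
      next
        case 7
        then show ?thesis using cd by auto
      qed
    qed
    moreover have "\<exists>d<c. y < h d"
      if c: "c \<le> b" "c \<noteq> 0" "\<And>d. c \<noteq> osucc d" "y < h c" for c y
    proof -
      have "c \<le> a \<or> c = b"
        using cases[OF c(1)] c(3) s_osucc by metis
      then show ?thesis
      proof
        assume "c \<le> a"
        then obtain d where "d < c" "y < g d"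
          using g(3)[rule_format, of c y] c by (auto simp: h_a)
        then show ?thesis
          using \<open>c \<le> a\<close> by (auto simp: h_a)
      next
        assume "c = b"
        then obtain t where "y < A m t"
          using lim[of y] c(4) h_b by auto
        then show ?thesis
          using s_b[of t] h_s[of t] \<open>c = b\<close> by (intro exI[of _ "s t"]) simp
      qed
    qed
    moreover have "h ` {..b} \<subseteq> ladder_points (Suc m) x A"
    proof
      fix z assume "z \<in> h ` {..b}"
      then obtain c where "c \<le> b" "z = h c"
        by auto
      then consider "c \<le> a" "z = g c" | j where "z = A m j" | "z = x (Suc m)"
        using cases[of c] h_a[of c] h_s h_b by metis
      then show "z \<in> ladder_points (Suc m) x A"
      proof cases
        case 1
        then have "z \<in> ladder_points m x A"
          using g(4) by auto
        then show ?thesis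
          by (auto simp: ladder_points_def less_Suc_eq)
      qed (auto simp: ladder_points_def)
    qed
    ultimately show ?case
      using h_b unfolding b_def[symmetric] by (intro exI[of _ h]) blast
  qed
  then obtain g where g: "strict_mono_on {..\<omega> * ord_of_nat m} g"
      "\<forall>c\<le>\<omega> * ord_of_nat m. c \<noteq> 0 \<longrightarrow> (\<forall>d. c \<noteq> osucc d) \<longrightarrow> (\<forall>y<g c. \<exists>d<c. y < g d)"
      "g ` {..\<omega> * ord_of_nat m} \<subseteq> ladder_points m x A"
    by (elim exE conjE) (rule that; assumption)
  have eq: "{..<\<omega> * ord_of_nat m + 1} = {..\<omega> * ord_of_nat m}"
    by (auto simp: ord_add_1 less_osucc_iff)
  have "closed_copy (g ` {..<\<omega> * ord_of_nat m + 1}) (\<omega> * ord_of_nat m + 1)"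
    using g(1) g(2)[rule_format]
    by (intro closed_copy_image) (simp_all add: eq[unfolded ord_add_1] ord_add_1 less_osucc_iff)
  then show ?thesis
    using g(3) unfolding eq by blast
qed

section \<open>Ramsey-theoretic normalization\<close>

text \<open>
  Ramsey's theorem for finitely many colourings at once, stated for increasing lists in place of finite
  sets, so that the positions of the entries can be addressed.
\<close>

lemma infinite_homogeneous_lists:
  fixes f :: "'i \<Rightarrow> nat list \<Rightarrow> colour" and r :: "'i \<Rightarrow> nat"
  assumes "finite I"
  obtains H where "infinite H"
    and "\<And>i. i \<in> I \<Longrightarrow> \<exists>t. \<forall>L. sorted_wrt (<) L \<and> set L \<subseteq> H \<and> length L = r i \<longrightarrow> f i L = t"
proof -
  have "\<exists>H. infinite H \<and>
      (\<forall>i\<in>I. \<exists>t. \<forall>L. sorted_wrt (<) L \<and> set L \<subseteq> H \<and> length L = r i \<longrightarrow> f i L = t)"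
    using assms
  proof (induction I)
    case empty
    show ?case by auto
  next
    case (insert i I)
    then obtain H where H: "infinite H"
      "\<forall>i\<in>I. \<exists>t. \<forall>L. sorted_wrt (<) L \<and> set L \<subseteq> H \<and> length L = r i \<longrightarrow> f i L = t"
      by blast
    let ?c = "\<lambda>S. case f i (sorted_list_of_set S) of Red \<Rightarrow> 0 | Blue \<Rightarrow> (1 :: nat)"
    have "\<forall>S. S \<subseteq> H \<and> finite S \<and> card S = r i \<longrightarrow> ?c S < 2"
      by (simp split: colour.split)
    from Ramsey[OF H(1) this] obtain H' t where H': "H' \<subseteq> H" "infinite H'"
      "\<forall>S. S \<subseteq> H' \<and> finite S \<and> card S = r i \<longrightarrow> ?c S = t"
      by blast
    have "f i L = (if t = 0 then Red else Blue)"
      if "sorted_wrt (<) L" "set L \<subseteq> H'" "length L = r i" for L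
    proof -
      have "card (set L) = r i" and "sorted_list_of_set (set L) = L"
        using that strict_sorted_iff distinct_card sorted_list_of_set.idem_if_sorted_distinct
        by (metis, metis)
      then show ?thesis
        using H'(3)[rule_format, of "set L"] that(2) by (cases "f i L") auto
    qed
    then show ?case
      using H' H(2) by (intro exI[of _ H']) (metis insert_iff subset_trans)
  qed
  then show thesis
    using that by blast
qed

lemma finite_ramsey_lists:
  fixes p q r :: nat
  obtains N :: nat where "\<And>f :: nat list \<Rightarrow> colour. \<exists>t d.
    strict_mono_on {..<(case t of Red \<Rightarrow> p | Blue \<Rightarrow> q)} d \<and>
    d ` {..<(case t of Red \<Rightarrow> p | Blue \<Rightarrow> q)} \<subseteq> {..<N} \<and>
    (\<forall>L. sorted_wrt (<) L \<and> set L \<subseteq> {..<(case t of Red \<Rightarrow> p | Blue \<Rightarrow> q)} \<and> length L = r \<longrightarrow>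
      f (map d L) = t)"
proof -
  obtain N :: nat where N: "partn_lst {..<N} [p, q] r"
    using ramsey2_full by blast
  show thesis
  proof (rule that)
    fix f :: "nat list \<Rightarrow> colour"
    let ?c = "\<lambda>S. case f (sorted_list_of_set S) of Red \<Rightarrow> 0 | Blue \<Rightarrow> (1 :: nat)"
    have "?c \<in> [{..<N}]\<^bsup>r\<^esup> \<rightarrow> {..<2}"
      by (auto split: colour.split)
    from partn_lstE[OF N this] obtain i H where
      i: "i < 2" and H: "H \<in> [{..<N}]\<^bsup>([p, q] ! i)\<^esup>" and hom: "?c ` [H]\<^bsup>r\<^esup> \<subseteq> {i}"
      by (metis One_nat_def Suc_1 length_Cons list.size(3))
    define t where "t = (if i = 0 then Red else Blue)"
    define d where "d = enumerate H"
    have size: "(case t of Red \<Rightarrow> p | Blue \<Rightarrow> q) = card H" "finite H" "H \<subseteq> {..<N}"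
      using i H by (auto simp: t_def nsets_def less_2_cases_iff)
    have mono: "strict_mono_on {..<card H} d"
      unfolding d_def by (intro strict_mono_onI finite_enumerate_mono) (use size in auto)
    have dH: "d ` {..<card H} \<subseteq> H"
      using finite_enumerate_in_set[OF size(2)] by (auto simp: d_def)
    have "f (map d L) = t" if L: "sorted_wrt (<) L" "set L \<subseteq> {..<card H}" "length L = r" for L
    proof -
      have sorted: "sorted_wrt (<) (map d L)"
        unfolding sorted_wrt_map
        by (rule sorted_wrt_mono_rel[OF _ L(1)]) (use L(2) mono in \<open>auto simp: strict_mono_on_def\<close>)
      then have "card (set (map d L)) = r" and list: "sorted_list_of_set (set (map d L)) = map d L"
        using L(3) strict_sorted_iff distinct_card sorted_list_of_set.idem_if_sorted_distinct
        by (metis length_map, metis)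
      then have "set (map d L) \<in> [H]\<^bsup>r\<^esup>"
        using L(2) dH by (auto simp: nsets_def)
      then have "?c (set (map d L)) = i"
        using hom by blast
      then show ?thesis
        unfolding list by (cases "f (map d L)") (auto simp: t_def)
    qed
    then show "\<exists>t d. strict_mono_on {..<(case t of Red \<Rightarrow> p | Blue \<Rightarrow> q)} d \<and>
        d ` {..<(case t of Red \<Rightarrow> p | Blue \<Rightarrow> q)} \<subseteq> {..<N} \<and>
        (\<forall>L. sorted_wrt (<) L \<and> set L \<subseteq> {..<(case t of Red \<Rightarrow> p | Blue \<Rightarrow> q)} \<and> length L = r \<longrightarrow>
          f (map d L) = t)"
      using mono dH size by (intro exI[of _ t] exI[of _ d]) auto
  qed
qed

text \<open>
  The colour \<open>g u v\<close> stands for that of an ancestor at depth \<open>u\<close> and a descendant at depth \<open>v\<close>, and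
  \<open>h u v w\<close> for that of successive nodes at depths \<open>v < w\<close> which branch at depth \<open>u\<close>. The first two
  alternatives produce blue cliques on \<open>k + 1\<close> nodes; in the first of them one depth more is
  needed, for the branching point.
\<close>

definition depth_ramsey :: "nat \<Rightarrow> nat \<Rightarrow> nat \<Rightarrow> bool" where
  "depth_ramsey k m N \<longleftrightarrow> (\<forall>(g :: nat \<Rightarrow> nat \<Rightarrow> colour) (h :: nat \<Rightarrow> nat \<Rightarrow> nat \<Rightarrow> colour). \<exists>d :: nat \<Rightarrow> nat.
    strict_mono_on {..Suc k} d \<and> d ` {..Suc k} \<subseteq> {..<N} \<and>
      (\<forall>i j l. i < j \<and> j < l \<and> l \<le> Suc k \<longrightarrow> h (d i) (d j) (d l) = Blue) \<or>
    strict_mono_on {..k} d \<and> d ` {..k} \<subseteq> {..<N} \<and>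
      (\<forall>i j. i < j \<and> j \<le> k \<longrightarrow> g (d i) (d j) = Blue) \<or>
    strict_mono_on {..m} d \<and> d ` {..m} \<subseteq> {..<N} \<and>
      (\<forall>i j. i < j \<and> j \<le> m \<longrightarrow> g (d i) (d j) = Red) \<and>
      (\<forall>i j l. i < j \<and> j < l \<and> l \<le> m \<longrightarrow> h (d i) (d j) (d l) = Red))"

text \<open>
  Ramsey's theorem for triples, with the number of red points so large that Ramsey's theorem for
  pairs applies to them in turn.
\<close>

lemma ex_depth_ramsey: "\<exists>N. depth_ramsey k m N"
proof -
  obtain M where M: "\<And>f :: nat list \<Rightarrow> colour. \<exists>t d.
    strict_mono_on {..<(case t of Red \<Rightarrow> Suc m | Blue \<Rightarrow> Suc k)} d \<and>
    d ` {..<(case t of Red \<Rightarrow> Suc m | Blue \<Rightarrow> Suc k)} \<subseteq> {..<M} \<and>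
    (\<forall>L. sorted_wrt (<) L \<and> set L \<subseteq> {..<(case t of Red \<Rightarrow> Suc m | Blue \<Rightarrow> Suc k)} \<and> length L = 2 \<longrightarrow>
      f (map d L) = t)"
    using finite_ramsey_lists[of "Suc m" "Suc k" 2] by metis
  obtain N where N: "\<And>f :: nat list \<Rightarrow> colour. \<exists>t d.
    strict_mono_on {..<(case t of Red \<Rightarrow> M | Blue \<Rightarrow> Suc (Suc k))} d \<and>
    d ` {..<(case t of Red \<Rightarrow> M | Blue \<Rightarrow> Suc (Suc k))} \<subseteq> {..<N} \<and>
    (\<forall>L. sorted_wrt (<) L \<and> set L \<subseteq> {..<(case t of Red \<Rightarrow> M | Blue \<Rightarrow> Suc (Suc k))} \<and> length L = 3 \<longrightarrow>
      f (map d L) = t)"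
    using finite_ramsey_lists[of M "Suc (Suc k)" 3] by metis
  show ?thesis
    unfolding depth_ramsey_def
  proof (intro exI[of _ N] allI)
    fix g :: "nat \<Rightarrow> nat \<Rightarrow> colour" and h :: "nat \<Rightarrow> nat \<Rightarrow> nat \<Rightarrow> colour"
    obtain t d where d: "strict_mono_on {..<(case t of Red \<Rightarrow> M | Blue \<Rightarrow> Suc (Suc k))} d"
      "d ` {..<(case t of Red \<Rightarrow> M | Blue \<Rightarrow> Suc (Suc k))} \<subseteq> {..<N}"
      and L: "\<forall>L. sorted_wrt (<) L \<and> set L \<subseteq> {..<(case t of Red \<Rightarrow> M | Blue \<Rightarrow> Suc (Suc k))} \<and> length L = 3 \<longrightarrow>
        h (map d L ! 0) (map d L ! 1) (map d L ! 2) = t"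
      using N[of "\<lambda>L. h (L ! 0) (L ! 1) (L ! 2)"] by (elim exE conjE) (rule that; assumption)
    have h: "h (d i) (d j) (d l) = t"
      if "i < j" "j < l" "l < (case t of Red \<Rightarrow> M | Blue \<Rightarrow> Suc (Suc k))" for i j l
      using L[rule_format, of "[i, j, l]"] that by simp
    obtain t' d' where d': "strict_mono_on {..<(case t' of Red \<Rightarrow> Suc m | Blue \<Rightarrow> Suc k)} d'"
      "d' ` {..<(case t' of Red \<Rightarrow> Suc m | Blue \<Rightarrow> Suc k)} \<subseteq> {..<M}"
      and L': "\<forall>L. sorted_wrt (<) L \<and> set L \<subseteq> {..<(case t' of Red \<Rightarrow> Suc m | Blue \<Rightarrow> Suc k)} \<and> length L = 2 \<longrightarrow>
        g (d (map d' L ! 0)) (d (map d' L ! 1)) = t'"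
      using M[of "\<lambda>L. g (d (L ! 0)) (d (L ! 1))"] by (elim exE conjE) (rule that; assumption)
    have g: "g (d (d' i)) (d (d' j)) = t'"
      if "i < j" "j < (case t' of Red \<Rightarrow> Suc m | Blue \<Rightarrow> Suc k)" for i j
      using L'[rule_format, of "[i, j]"] that by simp
    consider "t = Blue" | "t = Red" "t' = Blue" | "t = Red" "t' = Red"
      using colour.exhaust by metis
    then show "\<exists>d. strict_mono_on {..Suc k} d \<and> d ` {..Suc k} \<subseteq> {..<N} \<and>
        (\<forall>i j l. i < j \<and> j < l \<and> l \<le> Suc k \<longrightarrow> h (d i) (d j) (d l) = Blue) \<or>
      strict_mono_on {..k} d \<and> d ` {..k} \<subseteq> {..<N} \<and>
        (\<forall>i j. i < j \<and> j \<le> k \<longrightarrow> g (d i) (d j) = Blue) \<or>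
      strict_mono_on {..m} d \<and> d ` {..m} \<subseteq> {..<N} \<and>
        (\<forall>i j. i < j \<and> j \<le> m \<longrightarrow> g (d i) (d j) = Red) \<and>
        (\<forall>i j l. i < j \<and> j < l \<and> l \<le> m \<longrightarrow> h (d i) (d j) (d l) = Red)"
    proof cases
      case 1
      then show ?thesis
        using d h by (intro exI[of _ d] disjI1) (simp add: lessThan_Suc_atMost)
    next
      case 2
      have "strict_mono_on {..k} (d \<circ> d')"
        using d(1) d' 2 by (auto simp: strict_mono_on_def lessThan_Suc_atMost image_subset_iff)
      moreover have "(d \<circ> d') ` {..k} \<subseteq> {..<N}"
        using d(2) d'(2) 2 by (auto simp: lessThan_Suc_atMost image_subset_iff)
      ultimately show ?thesis
        using g 2 by (intro exI[of _ "d \<circ> d'"], intro disjI2[OF disjI1]) (simp add: less_Suc_eq_le)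
    next
      case 3
      have "strict_mono_on {..m} (d \<circ> d')"
        using d(1) d' 3 by (auto simp: strict_mono_on_def lessThan_Suc_atMost image_subset_iff)
      moreover have "(d \<circ> d') ` {..m} \<subseteq> {..<N}"
        using d(2) d'(2) 3 by (auto simp: lessThan_Suc_atMost image_subset_iff)
      moreover have "h (d (d' i)) (d (d' j)) (d (d' l)) = Red" if "i < j" "j < l" "l \<le> m" for i j l
        using h[of "d' i" "d' j" "d' l"] d' 3 that
        by (auto simp: strict_mono_on_def lessThan_Suc_atMost image_subset_iff)
      ultimately show ?thesis
        using g 3 by (intro exI[of _ "d \<circ> d'"] disjI2) (simp add: less_Suc_eq_le)
    qed
  qed
qed

text \<open>
  For each quadruple of lengths, cutting an increasing list into pieces \<open>w\<close>, \<open>p\<close>, \<open>r\<close>, \<open>p'\<close> of these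
  lengths turns \<open>C\<close> into a colouring of finite sets of natural numbers. There are finitely many
  quadruples, so a single infinite set is homogeneous for all of them; \<open>e\<close> enumerates it. Empty pieces
  cover the simpler positions: with \<open>r\<close> and \<open>p'\<close> empty one node is an ancestor of the other,
  and with \<open>p'\<close> empty the first node lies wholly before the second.
\<close>

lemma uniform_tree_colouring:
  fixes C :: "nat list \<Rightarrow> nat list \<Rightarrow> colour" and n :: nat
  shows "\<exists>(e :: nat \<Rightarrow> nat) \<chi>. strict_mono e \<and> (\<forall>w p r p'. sorted_wrt (<) (w @ p @ r @ p') \<longrightarrow>
      length w \<le> n \<longrightarrow> length p \<le> n \<longrightarrow> length r \<le> n \<longrightarrow> length p' \<le> n \<longrightarrow>
      C (map e (w @ p @ p')) (map e (w @ r)) = \<chi> (length w) (length p) (length r) (length p'))"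
proof -
  define f :: "nat \<times> nat \<times> nat \<times> nat \<Rightarrow> nat list \<Rightarrow> colour" where
    "f = (\<lambda>(u, a, b, a') L. C (take (u + a) L @ drop (u + a + b) L)
    (take u L @ take b (drop (u + a) L)))"
  define r :: "nat \<times> nat \<times> nat \<times> nat \<Rightarrow> nat" where "r = (\<lambda>(u, a, b, a'). u + a + b + a')"
  obtain H where H: "infinite H" and hom: "\<And>i. i \<in> {..n} \<times> {..n} \<times> {..n} \<times> {..n} \<Longrightarrow>
      \<exists>t. \<forall>L. sorted_wrt (<) L \<and> set L \<subseteq> H \<and> length L = r i \<longrightarrow> f i L = t"
    using infinite_homogeneous_lists[of "{..n} \<times> {..n} \<times> {..n} \<times> {..n}" r f] by blast
  from bchoice[of "{..n} \<times> {..n} \<times> {..n} \<times> {..n}"] hom obtain t where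
    t: "\<And>i L. \<lbrakk>i \<in> {..n} \<times> {..n} \<times> {..n} \<times> {..n}; sorted_wrt (<) L; set L \<subseteq> H; length L = r i\<rbrakk> \<Longrightarrow> f i L = t i"
    by metis
  have mono: "strict_mono (enumerate H)"
    by (intro strict_monoI enumerate_mono H)
  show ?thesis
  proof (intro exI[of _ "enumerate H"] exI[of _ "\<lambda>u a b a'. t (u, a, b, a')"] conjI allI impI)
    fix w p s p' :: "nat list"
    assume sorted: "sorted_wrt (<) (w @ p @ s @ p')"
      and len: "length w \<le> n" "length p \<le> n" "length s \<le> n" "length p' \<le> n"
    let ?L = "map (enumerate H) (w @ p @ s @ p')" and ?i = "(length w, length p, length s, length p')"
    have "sorted_wrt (<) ?L"
      unfolding sorted_wrt_map
      by (rule sorted_wrt_mono_rel[OF _ sorted]) (use mono in \<open>simp add: strict_mono_less\<close>)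
    moreover have "set ?L \<subseteq> H"
      using enumerate_in_set[OF H] by auto
    ultimately have "f ?i ?L = t ?i"
      using len by (intro t) (auto simp: r_def)
    then show "C (map (enumerate H) (w @ p @ p')) (map (enumerate H) (w @ s)) = t ?i"
      by (simp add: f_def)
  qed (rule mono)
qed

section \<open>The red configuration\<close>

lemma nsets_2_imageE:
  assumes "e \<in> [f ` S]\<^bsup>2\<^esup>"
  obtains s t where "s \<in> S" "t \<in> S" "s \<noteq> t" "e = {f s, f t}"
  using assms by (auto simp: nsets_2_eq)

lemma sorted_upt_append:
  "\<lbrakk>sorted_wrt (<) L; \<And>x. x \<in> set L \<Longrightarrow> b \<le> x\<rbrakk> \<Longrightarrow> sorted_wrt (<) ([a..<b] @ L)" for a b :: nat
  by (fastforce simp: sorted_wrt_append)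

lemma sorted_wrt_infix: "sorted_wrt R (w @ p @ q @ r) \<Longrightarrow> sorted_wrt R (p @ q)"
  by (simp add: sorted_wrt_append)

lemma sorted_blocks3:
  assumes "b1 \<le> a2" "a2 \<le> b2" "b2 \<le> a3"
  shows "sorted_wrt (<) ([a1..<b1] @ [a2..<b2] @ [a3..<b3])"
  using assms by (intro sorted_upt_append) auto

lemma sorted_blocks4:
  assumes "b1 \<le> a2" "a2 \<le> b2" "b2 \<le> a3" "a3 \<le> b3" "b3 \<le> a4"
  shows "sorted_wrt (<) ([a1..<b1] @ [a2..<b2] @ [a3..<b3] @ [a4..<b4])"
  by (rule sorted_upt_append, rule sorted_blocks3) (use assms in auto)

lemma sorted_blocks5:
  assumes "b1 \<le> a2" "a2 \<le> b2" "b2 \<le> a3" "a3 \<le> b3" "b3 \<le> a4" "a4 \<le> b4" "b4 \<le> a5"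
  shows "sorted_wrt (<) ([a1..<b1] @ [a2..<b2] @ [a3..<b3] @ [a4..<b4] @ [a5..<b5])"
  by (rule sorted_upt_append, rule sorted_blocks4) (use assms in auto)

text \<open>
  The situation after thinning out: \<open>\<chi> u a b a'\<close> is the colour of two nodes with a common part of
  length \<open>u\<close>, after which the first node has \<open>a\<close> coordinates below and \<open>a'\<close> coordinates above all of
  the \<open>b\<close> coordinates of the second.
\<close>

locale uniform_coloured_tree = tree_embedding n \<phi>
  for n :: nat and \<phi> :: "nat list \<Rightarrow> 'a::linorder" +
  fixes c :: "'a set \<Rightarrow> colour" and k :: nat and \<chi> :: "nat \<Rightarrow> nat \<Rightarrow> nat \<Rightarrow> nat \<Rightarrow> colour"
  assumes colour_eq: "\<lbrakk>sorted_wrt (<) (w @ p @ r @ p'); length (w @ p @ p') \<le> n; length (w @ r) \<le> n\<rbrakk> \<Longrightarrow>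
      c {\<phi> (w @ p @ p'), \<phi> (w @ r)} = \<chi> (length w) (length p) (length r) (length p')"
    and no_blue_clique: "\<lbrakk>Y \<subseteq> \<phi> ` {s. length s \<le> n}; card Y = Suc k\<rbrakk> \<Longrightarrow> \<exists>e\<in>[Y]\<^bsup>2\<^esup>. c e = Red"
begin

lemma not_pairwise_blue:
  assumes len: "\<And>i. i \<le> k \<Longrightarrow> length (v i) \<le> n"
    and neq: "\<And>i j. \<lbrakk>i < j; j \<le> k\<rbrakk> \<Longrightarrow> \<phi> (v i) \<noteq> \<phi> (v j)"
  shows "\<exists>i j. i < j \<and> j \<le> k \<and> c {\<phi> (v i), \<phi> (v j)} = Red"
proof -
  let ?Y = "(\<lambda>i. \<phi> (v i)) ` {..k}"
  have "inj_on (\<lambda>i. \<phi> (v i)) {..k}"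
    using neq by (intro linorder_inj_onI) auto
  then have "card ?Y = Suc k"
    by (simp add: card_image)
  moreover have "?Y \<subseteq> \<phi> ` {s. length s \<le> n}"
    using len by auto
  ultimately obtain e where e: "e \<in> [?Y]\<^bsup>2\<^esup>" "c e = Red"
    using no_blue_clique by meson
  then obtain i j where "i \<le> k" "j \<le> k" "i \<noteq> j" "e = {\<phi> (v i), \<phi> (v j)}"
    by (auto simp: nsets_2_eq) 
  then show ?thesis
    using e(2) by (metis insert_commute linorder_neqE)
qed

lemma less_diverging:
  assumes "sorted_wrt (<) (p @ r)" "p \<noteq> []" "r \<noteq> []"
    and "length (w @ p @ p') \<le> n" "length (w @ r @ r') \<le> n"
  shows "\<phi> (w @ p @ p') < \<phi> (w @ r @ r')"
  using assms less_sibling[of "hd p" "hd r" w "tl p @ p'" "tl r @ r'"]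
  by (cases p; cases r) auto

lemma less_prefix:
  assumes "p \<noteq> []" "length (w @ p) \<le> n"
  shows "\<phi> (w @ p) < \<phi> w"
  using assms less_ancestor[of w "hd p" "tl p"] by (cases p) auto

text \<open>
  Nodes \<open>w @ p\<^sub>s @ p'\<^sub>s\<close> with \<open>w < p\<^sub>0 < \<dots> < p\<^sub>k < p'\<^sub>k < \<dots> < p'\<^sub>0\<close> are pairwise in the same position,
  since all further coordinates of a later node fall between the two blocks of an earlier one.
\<close>

lemma nested_red:
  assumes "a > 0" "u + a + a' \<le> n"
  shows "\<chi> u a (a + a') a' = Red"
proof -
  let ?w = "[0..<u]"
  let ?p = "\<lambda>s. [u + s * a..<u + s * a + a]"
  \<comment> \<open>The blocks \<open>p\<^sub>s\<close> end at \<open>?M\<close>; above it the blocks \<open>p'\<^sub>s\<close> are laid out in reverse order.\<close>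
  let ?M = "u + Suc k * a"
  let ?p' = "\<lambda>s. [?M + (k - s) * a'..<?M + (k - s) * a' + a']"
  have sorted: "sorted_wrt (<) (?w @ ?p i @ (?p j @ ?p' j) @ ?p' i)" if "i < j" "j \<le> k" for i j
  proof -
    have a: "i * a + a \<le> j * a"
      using mult_le_mono1[of "Suc i" j a] that by simp
    have b: "j * a + a \<le> Suc k * a"
      using mult_le_mono1[of "Suc j" "Suc k" a] that by simp
    have c: "(k - j) * a' + a' \<le> (k - i) * a'"
      using mult_le_mono1[of "Suc (k - j)" "k - i" a'] diff_less_mono2[of i j k] that
      by (simp add: Suc_le_eq add.commute)
    have "sorted_wrt (<) (?w @ ?p i @ ?p j @ ?p' j @ ?p' i)"
      by (rule sorted_blocks5) (use a b c in linarith)+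
    then show ?thesis by simp
  qed
  let ?v = "\<lambda>s. ?w @ ?p s @ ?p' s"
  have len: "length (?v s) \<le> n" for s
    using assms by simp
  have "\<phi> (?v i) \<noteq> \<phi> (?v j)" if "i < j" "j \<le> k" for i j
  proof -
    have "sorted_wrt (<) (?p i @ ?p j)"
      by (rule sorted_wrt_infix[of _ ?w _ _ "?p' j @ ?p' i"]) (use sorted[OF that] in \<open>simp only: append_assoc\<close>)
    then show ?thesis
      using less_diverging[of "?p i" "?p j" ?w "?p' i" "?p' j"] assms by simp
  qed
  with not_pairwise_blue[of ?v] len obtain i j where
    ij: "i < j" "j \<le> k" "c {\<phi> (?v i), \<phi> (?v j)} = Red"
    by blast
  then show ?thesis
    using colour_eq[OF sorted[OF ij(1,2)]] assms by (simp add: add.assoc)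
qed

text \<open>
  Otherwise the nodes at these \<open>k + 1\<close> depths on a single branch would form a blue clique.
\<close>

lemma exists_red_chain_pair:
  assumes "strict_mono_on {..k} d" "d ` {..k} \<subseteq> {..n}"
  shows "\<exists>i j. i < j \<and> j \<le> k \<and> \<chi> (d i) (d j - d i) 0 0 = Red"
proof -
  let ?v = "\<lambda>i. [0..<d i]"
  have less: "d i < d j" "d j \<le> n" if "i < j" "j \<le> k" for i j
    using that assms by (auto simp: strict_mono_on_def image_subset_iff)
  have v: "?v j = ?v i @ [d i..<d j]" if "i < j" "j \<le> k" for i j
    using less[OF that] upt_add_eq_append[of 0 "d i" "d j - d i"] by simp
  have "\<phi> (?v j) < \<phi> (?v i)" if "i < j" "j \<le> k" for i j
    unfolding v[OF that] by (rule less_prefix) (use less[OF that] in auto)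
  then have "\<phi> (?v i) \<noteq> \<phi> (?v j)" if "i < j" "j \<le> k" for i j
    using that by (metis order.irrefl)
  then have "\<exists>i j. i < j \<and> j \<le> k \<and> c {\<phi> (?v i), \<phi> (?v j)} = Red"
    using assms(2) by (intro not_pairwise_blue) (auto simp: image_subset_iff)
  then obtain i j where ij: "i < j" "j \<le> k" "c {\<phi> (?v j), \<phi> (?v i)} = Red"
    by (auto simp: insert_commute)
  have "sorted_wrt (<) (?v i @ [d i..<d j])"
    unfolding v[OF ij(1,2), symmetric] by simp
  then show ?thesis
    using colour_eq[of "?v i" "[d i..<d j]" "[]" "[]"] ij less[OF ij(1,2)] v[OF ij(1,2)]
    by (intro exI[of _ i] exI[of _ j]) simp
qed

text \<open>
  The least depth serves as the branching point \<open>w\<close>; the other \<open>k + 1\<close> depths are realized by nodes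
  extending \<open>w\<close> by blocks one after the other, in order of increasing depth.
\<close>

lemma exists_red_successive_pair:
  assumes "strict_mono_on {..Suc k} d" "d ` {..Suc k} \<subseteq> {..n}"
  shows "\<exists>i j l. i < j \<and> j < l \<and> l \<le> Suc k \<and> \<chi> (d i) (d j - d i) (d l - d i) 0 = Red"
proof -
  let ?w = "[0..<d 0]"
  let ?r = "\<lambda>i. [d 0 + i * n..<d 0 + i * n + (d (Suc i) - d 0)]"
  have bound: "d 0 < d (Suc i)" "d (Suc i) \<le> n" if "i \<le> k" for i
    using that assms by (auto simp: strict_mono_on_def image_subset_iff)
  have sorted: "sorted_wrt (<) (?w @ ?r i @ ?r j)" if "i < j" "j \<le> k" for i j
  proof -
    have "i * n + n \<le> j * n"
      using mult_le_mono1[of "Suc i" j n] that by simp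
    moreover have "d (Suc i) \<le> n"
      using bound[of i] that by simp
    ultimately show ?thesis
      by (intro sorted_blocks3) linarith+
  qed
  have "\<phi> (?w @ ?r i) \<noteq> \<phi> (?w @ ?r j)" if "i < j" "j \<le> k" for i j
  proof -
    have "sorted_wrt (<) (?r i @ ?r j)"
      by (rule sorted_wrt_infix[of _ ?w _ _ "[]"]) (use sorted[OF that] in \<open>simp only: append_Nil2\<close>)
    then show ?thesis
      using less_diverging[of "?r i" "?r j" ?w "[]" "[]"] bound[of i] bound[of j] that by simp
  qed
  moreover have "length (?w @ ?r i) \<le> n" if "i \<le> k" for i
    using bound[OF that] by simp
  ultimately obtain i j where ij: "i < j" "j \<le> k" "c {\<phi> (?w @ ?r i), \<phi> (?w @ ?r j)} = Red"
    using not_pairwise_blue[of "\<lambda>i. ?w @ ?r i"] by blast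
  then have "\<chi> (d 0) (d (Suc i) - d 0) (d (Suc j) - d 0) 0 = Red"
    using colour_eq[of ?w "?r i" "?r j" "[]"] sorted[OF ij(1,2)] bound[of i] bound[of j] by simp
  then show ?thesis
    using ij by (intro exI[of _ 0] exI[of _ "Suc i"] exI[of _ "Suc j"]) simp
qed

text \<open>
  The limit points are the nodes at the given depths on the branch \<open>0, 1, 2, \<dots>\<close>, listed by \<open>h\<close> from the
  deepest one upwards, since the order is post-order. The sequence converging to one of them extends it
  to the maximal depth \<open>D\<close> by disjoint blocks. A limit point and a point of a sequence form an
  ancestor pair or a successive pair. Two points of sequences have equal depth, and so fall under the
  nested pattern, as does \<open>x 0\<close>, which lies at depth \<open>D\<close> as well: if the point belonging to the deeper
  limit comes with the later block, the other block separates its segment of the branch from its own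
  block.
\<close>

lemma red_configuration:
  assumes d: "strict_mono_on {..m} d" "d ` {..m} \<subseteq> {..n}"
    and red2: "\<And>i j. \<lbrakk>i < j; j \<le> m\<rbrakk> \<Longrightarrow> \<chi> (d i) (d j - d i) 0 0 = Red"
    and red3: "\<And>i j l. \<lbrakk>i < j; j < l; l \<le> m\<rbrakk> \<Longrightarrow> \<chi> (d i) (d j - d i) (d l - d i) 0 = Red"
  shows "\<exists>x A. omega_ladder m x A \<and> ladder_points m x A \<subseteq> \<phi> ` {s. length s \<le> n} \<and>
    (\<forall>e\<in>[ladder_points m x A]\<^bsup>2\<^esup>. c e = Red)"
proof -
  define D where "D = d m"
  define h where "h i = d (m - i)" for i
  have h: "h j < h i" if "i < j" "j \<le> m" for i j
    using that d(1) by (auto simp: h_def strict_mono_on_def)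
  have h0: "h 0 = D" and h_le: "h i \<le> D" "h i \<le> n" and "D \<le> n" for i
    using d by (auto simp: h_def D_def image_subset_iff strict_mono_on_leD)
  have red2': "\<chi> (h j) (h i - h j) 0 0 = Red" if "i < j" "j \<le> m" for i j
    using red2[of "m - j" "m - i"] that by (simp add: h_def)
  have red3': "\<chi> (h j) (h i - h j) (D - h j) 0 = Red" if "i < j" "j \<le> m" for i j
  proof (cases "i = 0")
    case True
    then show ?thesis
      using nested_red[of "D - h j" "h j" 0] h[OF that] \<open>D \<le> n\<close> by (simp add: h0)
  next
    case False
    then show ?thesis
      using red3[of "m - j" "m - i" m] that by (simp add: h_def D_def)
  qed
  \<comment> \<open>The start of the \<open>t\<close>-th block of sequence \<open>j\<close>. Blocks have length at most \<open>D\<close>, they lie above the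
    branch, and for \<open>j \<le> m\<close> the index \<open>t * Suc m + j\<close> determines \<open>t\<close> and \<open>j\<close>, so they are disjoint.\<close>
  define B where "B j t = D + (t * Suc m + j) * D" for j t
  let ?x = "\<lambda>i. [0..<h i]"
  let ?r = "\<lambda>j t. [B j t..<B j t + (D - h j)]"
  let ?a = "\<lambda>j t. ?x j @ ?r j t"
  have split: "?x i = ?x j @ [h j..<h i]" if "i < j" "j \<le> m" for i j
    using h[OF that] upt_add_eq_append[of 0 "h j" "h i - h j"] by simp
  have B_ge: "D \<le> B j t" for j t
    by (simp add: B_def)
  have B_less: "B i s + D \<le> B j t" if "s * Suc m + i < t * Suc m + j" for i j s t
    using mult_le_mono1[of "Suc (s * Suc m + i)" "t * Suc m + j" D] that
    by (simp add: B_def del: mult_Suc_right)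
  have B_Suc: "B j s + D \<le> B j t" if "s < t" for j s t
    using that mult_le_mono1[of "Suc s" t "Suc m"] by (intro B_less) (simp del: mult_Suc_right)
  have B_cases: "B i s + D \<le> B j t \<or> B j t + D \<le> B i s" if "i < j" "j \<le> m" for i j s t
  proof (cases "t < s")
    case True
    then show ?thesis
      using mult_le_mono1[of "Suc t" s "Suc m"] that B_less[of t j s i] by simp
  next
    case False
    then show ?thesis
      using mult_le_mono1[of s t "Suc m"] that B_less[of s i t j] by simp
  qed
  have len_x: "length (?x i) \<le> n" and len_a: "length (?a j t) \<le> n" for i j t
    using h_le[of i] h_le[of j] \<open>D \<le> n\<close> by simp_all
  have hD: "h j < D" if "0 < j" "j \<le> m" for j
    using h[OF that] h0 by simp
  have xx: "c {\<phi> (?x i), \<phi> (?x j)} = Red" if "i < j" "j \<le> m" for i j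
    using colour_eq[of "?x j" "[h j..<h i]" "[]" "[]"] red2'[OF that] h_le[of i] h_le[of j]
    by (simp flip: split[OF that])
  have xa_below: "c {\<phi> (?x i), \<phi> (?a j t)} = Red" if "i < j" "j \<le> m" for i j t
  proof -
    have "sorted_wrt (<) (?x j @ [h j..<h i] @ ?r j t)"
      by (rule sorted_blocks3) (use h[OF that] h_le[of i] B_ge[of j t] in linarith)+
    then show ?thesis
      using colour_eq[of "?x j" "[h j..<h i]" "?r j t" "[]"] red3'[OF that] len_x[of i] len_a[of j t]
      by (simp flip: split[OF that])
  qed
  have xa_above: "c {\<phi> (?x i), \<phi> (?a j t)} = Red" if "0 < j" "j \<le> i" "i \<le> m" for i j t
  proof -
    have eq: "?a j t = ?x i @ [h i..<h j] @ ?r j t"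
      using split[of j i] that by (cases "i = j") auto
    have le: "h i \<le> h j" "h i < D"
      using h[of j i] that hD[of i] by (cases "i = j"; simp)+
    have "sorted_wrt (<) (?x i @ [h i..<h j] @ ?r j t)"
      by (rule sorted_blocks3) (use le h_le[of j] B_ge[of j t] in linarith)+
    then show ?thesis
      using colour_eq[of "?x i" "[h i..<h j] @ ?r j t" "[]" "[]"] len_x[of i] len_a[of j t] le h_le[of j]
        red2'[of 0 i] that
      unfolding eq by (simp add: h0 insert_commute)
  qed
  have nested0: "\<chi> (h j) (D - h j) (D - h j) 0 = Red" if "0 < j" "j \<le> m" for j
    using nested_red[of "D - h j" "h j" 0] hD[OF that] \<open>D \<le> n\<close> by simp
  have aa: "c {\<phi> (?a j s), \<phi> (?a j t)} = Red" if "s < t" "0 < j" "j \<le> m" for j s t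
  proof -
    have "sorted_wrt (<) (?x j @ ?r j s @ ?r j t)"
      by (rule sorted_blocks3) (use h_le[of j] B_ge[of j s] B_Suc[OF that(1), of j] in linarith)+
    then show ?thesis
      using colour_eq[of "?x j" "?r j s" "?r j t" "[]"] nested0[OF that(2,3)] len_a[of j s] len_a[of j t]
      by simp
  qed
  have ab: "c {\<phi> (?a i s), \<phi> (?a j t)} = Red" if "i < j" "j \<le> m" for i j s t
    using B_cases[OF that, of s t]
  proof
    assume le: "B i s + D \<le> B j t"
    have "sorted_wrt (<) (?x j @ [h j..<h i] @ ?r i s @ ?r j t)"
      by (rule sorted_blocks4) (use h[OF that] h_le[of i] B_ge[of i s] le in linarith)+
    then show ?thesis
      using colour_eq[of "?x j" "[h j..<h i] @ ?r i s" "?r j t" "[]"] nested0[of j]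
        len_a[of i s] len_a[of j t] h[OF that] h_le[of i] that
      by (simp add: split[OF that])
  next
    assume le: "B j t + D \<le> B i s"
    have "sorted_wrt (<) (?x j @ [h j..<h i] @ ?r j t @ ?r i s)"
      by (rule sorted_blocks4) (use h[OF that] h_le[of i] B_ge[of j t] le in linarith)+
    moreover have "\<chi> (h j) (h i - h j) (D - h j) (D - h i) = Red"
      using nested_red[of "h i - h j" "h j" "D - h i"] h[OF that] h_le[of i] \<open>D \<le> n\<close> by simp
    ultimately show ?thesis
      using colour_eq[of "?x j" "[h j..<h i]" "?r j t" "?r i s"]
        len_a[of i s] len_a[of j t] h[OF that] h_le[of i] that
      by (simp add: split[OF that])
  qed
  let ?S = "?x ` {..m} \<union> (\<Union>j<m. range (?a (Suc j)))"
  have red: "c {\<phi> s, \<phi> t} = Red" if "s \<in> ?S" "t \<in> ?S" "s \<noteq> t" for s t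
  proof -
    have swap: "c {\<phi> s, \<phi> t} = c {\<phi> t, \<phi> s}" for s t
      by (simp add: insert_commute)
    have xa: "c {\<phi> (?x i), \<phi> (?a (Suc j) l)} = Red" if "i \<le> m" "j < m" for i j l
      using xa_below[of i "Suc j" l] xa_above[of "Suc j" i l] that by (cases "i < Suc j") auto
    have xx': "c {\<phi> (?x i), \<phi> (?x j)} = Red" if "i \<le> m" "j \<le> m" "?x i \<noteq> ?x j" for i j
      using xx[of i j] xx[of j i] swap that by (cases i j rule: linorder_cases) auto
    have aa': "c {\<phi> (?a (Suc i) q), \<phi> (?a (Suc j) l)} = Red"
      if "i < m" "j < m" "?a (Suc i) q \<noteq> ?a (Suc j) l" for i j q l
    proof (cases i j rule: linorder_cases)
      case equal
      then show ?thesis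
        using aa[of q l "Suc i"] aa[of l q "Suc i"] swap that
        by (cases q l rule: linorder_cases) auto
    qed (use ab[of "Suc i" "Suc j" q l] ab[of "Suc j" "Suc i" l q] swap that in auto)
    have cases: "(\<exists>i\<le>m. s = ?x i) \<or> (\<exists>j<m. \<exists>l. s = ?a (Suc j) l)" if "s \<in> ?S" for s
      using that by blast
    from cases[OF that(1)] show ?thesis
    proof (elim disjE exE conjE)
      fix i assume i: "i \<le> m" "s = ?x i"
      from cases[OF that(2)] show ?thesis
      proof (elim disjE exE conjE)
        fix j assume "j \<le> m" "t = ?x j"
        with i that(3) show ?thesis
          using xx'[of i j] by blast
      next
        fix j l assume "j < m" "t = ?a (Suc j) l"
        with i show ?thesis
          using xa[of i j l] by blast
      qed
    next
      fix i q assume i: "i < m" "s = ?a (Suc i) q"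
      from cases[OF that(2)] show ?thesis
      proof (elim disjE exE conjE)
        fix j assume "j \<le> m" "t = ?x j"
        with i have "c {\<phi> t, \<phi> s} = Red"
          using xa[of j i q] by blast
        then show ?thesis
          by (simp only: swap[of s t])
      next
        fix j l assume "j < m" "t = ?a (Suc j) l"
        with i that(3) show ?thesis
          using aa'[of i j q l] by blast
      qed
    qed
  qed
  let ?X = "\<lambda>i. \<phi> (?x i)" and ?A = "\<lambda>j t. \<phi> (?a (Suc j) t)"
  have "omega_ladder m ?X ?A"
    unfolding omega_ladder_def
  proof (intro allI impI conjI)
    show "strict_mono (\<lambda>t. \<phi> (?a (Suc j) t))" if "j < m" for j
    proof (rule strict_monoI)
      fix s t :: nat assume "s < t"
      then show "\<phi> (?a (Suc j) s) < \<phi> (?a (Suc j) t)"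
        using less_diverging[of "?r (Suc j) s" "?r (Suc j) t" "?x (Suc j)" "[]" "[]"]
          len_a[of "Suc j" s] len_a[of "Suc j" t] hD[of "Suc j"] that
          sorted_blocks3[of 0 "B (Suc j) s" "B (Suc j) s + (D - h (Suc j))" "B (Suc j) t" 0]
          B_Suc[of s t "Suc j"]
        by simp
    qed
    show "\<phi> (?x j) < \<phi> (?a (Suc j) 0)" if "j < m" for j
      using less_diverging[of "[h (Suc j)..<h j]" "?r (Suc j) 0" "?x (Suc j)" "[]" "[]"]
        sorted_blocks3[of 0 "h (Suc j)" "h j" "B (Suc j) 0" 0]
        split[of j "Suc j"] h[of j "Suc j"] hD[of "Suc j"] that
        B_ge[of "Suc j" 0] h_le[of j] len_x[of j] len_a[of "Suc j" 0]
      by simp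
    show "\<phi> (?a (Suc j) t) < \<phi> (?x (Suc j))" if "j < m" for j t
      using less_prefix[of "?r (Suc j) t" "?x (Suc j)"] len_a[of "Suc j" t] hD[of "Suc j"] that by simp
    show "\<exists>t. y < \<phi> (?a (Suc j) t)" if y: "j < m" "y < \<phi> (?x (Suc j))" for j y
    proof -
      have "length (?x (Suc j)) < n"
        using hD[of "Suc j"] \<open>D \<le> n\<close> y by simp
      then obtain J where J: "\<And>i p. \<lbrakk>J \<le> i; length (?x (Suc j) @ i # p) \<le> n\<rbrakk> \<Longrightarrow> y < \<phi> (?x (Suc j) @ i # p)"
        using descendants_cofinal[OF y(2)] by blast
      have "J \<le> J * Suc m + Suc j"
        by simp
      also have "\<dots> \<le> (J * Suc m + Suc j) * D"
        using hD[of "Suc j"] y by (cases D) simp_all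
      also have "\<dots> \<le> B (Suc j) J"
        unfolding B_def by (rule le_add2)
      finally have "J \<le> B (Suc j) J" .
      moreover have "?r (Suc j) J = B (Suc j) J # tl (?r (Suc j) J)"
        using hD[of "Suc j"] y by (simp add: upt_conv_Cons)
      ultimately show ?thesis
        using J len_a[of "Suc j" J] by metis
    qed
  qed
  moreover have eq: "ladder_points m ?X ?A = \<phi> ` ?S"
    by (simp add: ladder_points_def image_Un image_UN image_image)
  have "ladder_points m ?X ?A \<subseteq> \<phi> ` {s. length s \<le> n}"
    unfolding eq using len_x len_a by (intro image_mono) auto
  moreover have "c e = Red" if "e \<in> [ladder_points m ?X ?A]\<^bsup>2\<^esup>" for e
    using that unfolding eq by (rule nsets_2_imageE) (hypsubst, rule red)
  ultimately show ?thesis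
    by (intro exI[of _ ?X] exI[of _ ?A]) blast
qed

end

section \<open>The bound\<close>

theorem theorem6p1:
  fixes k m :: nat
  assumes "k > 0" and "m > 0"
  shows "(\<exists>\<beta>. closed_arrow \<beta> (\<omega> * ord_of_nat m + 1) (k + 1)) \<and>
    Rcl (\<omega> * ord_of_nat m + 1) (k + 1) < \<omega> \<up> \<omega>"
proof -
  obtain n where n: "depth_ramsey k m n"
    using ex_depth_ramsey by blast
  \<comment> \<open>The root of the tree is the point \<open>\<omega>\<^sup>n\<close> itself, which lies below \<open>\<omega>\<^sup>n\<^sup>+\<^sup>1\<close>.\<close>
  let ?\<beta> = "add_power (Suc n) 0" and ?\<alpha> = "\<omega> * ord_of_nat m + 1"
  have "closed_arrow ?\<beta> ?\<alpha> (k + 1)"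
    unfolding closed_arrow_def
  proof (intro allI, rule disjCI)
    fix c :: "ordinal set \<Rightarrow> colour"
    assume "\<nexists>Y. Y \<in> [{..<?\<beta>}]\<^bsup>(k + 1)\<^esup> \<and> (\<forall>e\<in>[Y]\<^bsup>2\<^esup>. c e = Blue)"
    then have no_blue: "\<exists>e\<in>[Y]\<^bsup>2\<^esup>. c e = Red" if "Y \<in> [{..<?\<beta>}]\<^bsup>(k + 1)\<^esup>" for Y
      using that by (metis colour.exhaust)
    let ?\<phi> = "tree_point n 0"
    have below: "?\<phi> s < ?\<beta>" if "length s \<le> n" for s
    proof -
      have "(add_power n ^^ 1) 0 < ?\<beta>"
        unfolding add_power.simps by (rule strict_mono_SUP_not_osucc(3)[OF strict_mono_add_power_iterates])
      then show ?thesis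
        using tree_point_bounds[OF that, of 0] by auto
    qed
    obtain e :: "nat \<Rightarrow> nat" and \<chi> where "strict_mono e"
      and \<chi>: "\<forall>w p r p'. sorted_wrt (<) (w @ p @ r @ p') \<longrightarrow>
        length w \<le> n \<longrightarrow> length p \<le> n \<longrightarrow> length r \<le> n \<longrightarrow> length p' \<le> n \<longrightarrow>
        c {?\<phi> (map e (w @ p @ p')), ?\<phi> (map e (w @ r))} =
          \<chi> (length w) (length p) (length r) (length p')"
      using uniform_tree_colouring[of n "\<lambda>s t. c {?\<phi> s, ?\<phi> t}"] by blast
    let ?\<psi> = "?\<phi> \<circ> map e"
    have below': "?\<psi> ` {s. length s \<le> n} \<subseteq> {..<?\<beta>}"
      using below by auto
    interpret tree_embedding n ?\<psi>
      by (rule tree_embedding_comp_map[OF tree_embedding_tree_point \<open>strict_mono e\<close>])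
    interpret uniform_coloured_tree n ?\<psi> c k \<chi>
    proof
      show "c {?\<psi> (w @ p @ p'), ?\<psi> (w @ r)} = \<chi> (length w) (length p) (length r) (length p')"
        if "sorted_wrt (<) (w @ p @ r @ p')" "length (w @ p @ p') \<le> n" "length (w @ r) \<le> n"
        for w p r p'
        using \<chi>[rule_format, of w p r p'] that by simp
      show "\<exists>e\<in>[Y]\<^bsup>2\<^esup>. c e = Red" if "Y \<subseteq> ?\<psi> ` {s. length s \<le> n}" "card Y = Suc k" for Y
        using that below' by (intro no_blue) (auto simp: nsets_def intro: card_ge_0_finite)
    qed
    obtain d where "strict_mono_on {..m} d" "d ` {..m} \<subseteq> {..n}"
      "\<And>i j. \<lbrakk>i < j; j \<le> m\<rbrakk> \<Longrightarrow> \<chi> (d i) (d j - d i) 0 0 = Red"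
      "\<And>i j l. \<lbrakk>i < j; j < l; l \<le> m\<rbrakk> \<Longrightarrow> \<chi> (d i) (d j - d i) (d l - d i) 0 = Red"
    proof -
      have mono: "{..<n} \<subseteq> {..n}"
        by auto
      from n[unfolded depth_ramsey_def, THEN spec[of _ "\<lambda>u v. \<chi> u (v - u) 0 0"],
          THEN spec[of _ "\<lambda>u v w. \<chi> u (v - u) (w - u) 0"]]
      show thesis
      proof (elim exE disjE conjE)
        fix d
        assume "strict_mono_on {..Suc k} d" "d ` {..Suc k} \<subseteq> {..<n}"
          "\<forall>i j l. i < j \<and> j < l \<and> l \<le> Suc k \<longrightarrow> \<chi> (d i) (d j - d i) (d l - d i) 0 = Blue"
        then show thesis
          using exists_red_successive_pair[of d] mono by fastforce
      next
        fix d
        assume "strict_mono_on {..k} d" "d ` {..k} \<subseteq> {..<n}"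
          "\<forall>i j. i < j \<and> j \<le> k \<longrightarrow> \<chi> (d i) (d j - d i) 0 0 = Blue"
        then show thesis
          using exists_red_chain_pair[of d] mono by fastforce
      next
        fix d
        assume "strict_mono_on {..m} d" "d ` {..m} \<subseteq> {..<n}"
          "\<forall>i j. i < j \<and> j \<le> m \<longrightarrow> \<chi> (d i) (d j - d i) 0 0 = Red"
          "\<forall>i j l. i < j \<and> j < l \<and> l \<le> m \<longrightarrow> \<chi> (d i) (d j - d i) (d l - d i) 0 = Red"
        then show thesis
          using mono by (intro that[of d]) auto
      qed
    qed
    from red_configuration[OF this] obtain x A where ladder: "omega_ladder m x A"
      and sub: "ladder_points m x A \<subseteq> ?\<psi> ` {s. length s \<le> n}"
      and red: "\<forall>e\<in>[ladder_points m x A]\<^bsup>2\<^esup>. c e = Red"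
      by blast
    obtain X where X: "X \<subseteq> ladder_points m x A" "closed_copy X ?\<alpha>"
      using closed_copy_in_ladder[OF ladder] by blast
    have "X \<subseteq> {..<?\<beta>}"
      using X(1) sub below' by blast
    moreover have "c e = Red" if "e \<in> [X]\<^bsup>2\<^esup>" for e
      using red nsets_mono[OF X(1)] that by blast
    ultimately show "\<exists>X. X \<subseteq> {..<?\<beta>} \<and> closed_copy X ?\<alpha> \<and> (\<forall>e\<in>[X]\<^bsup>2\<^esup>. c e = Red)"
      using X(2) by blast
  qed
  then show ?thesis
    using add_power_less_omega_omega[of "Suc n"] unfolding Rcl_def
    by (blast intro: Least_le order.strict_trans1)
qed

end
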